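(* Let $\mathfrak g$ be a finite-dimensional semisimple Lie algebra and $M$ a finitely generated $U(\mathfrak g)$-module. Let $M_0,M_0'$ be finite-dimensional subspaces of $M$ with $U(\mathfrak g)M_0=U(\mathfrak g)M_0'=M$. Then the polynomials $\mathfrak p_{M,M_0}$ and $\mathfrak p_{M,M_0'}$ have the same leading coefficient.
   Context: $\mathbb F$ is a field of characteristic $0$. $U_k(\mathfrak g)$, $k\in\mathbb N$, is the standard filtration of the universal enveloping algebra $U(\mathfrak g)$. For a finite-dimensional subspace $M_0$ of $M$ with $U(\mathfrak g)M_0=M$, put $M_k=U_k(\mathfrak g)M_0$; $\mathfrak p_{M,M_0}$ is the polynomial with $\mathfrak p_{M,M_0}(k)=\dim(M_k/M_{k-1})$ for all sufficiently large $k$. *)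

theory Defs
  imports
    "HOL-Library.Poly_Mapping"
    "HOL-Computational_Algebra.Polynomial"
    "HOL-Algebra.QuotRing"
begin

subsection \<open>Finite-dimensional subspaces and the dimension of a quotient space\<close>

definition fin_dim_subspace :: "('f::field \<Rightarrow> 'v::ab_group_add \<Rightarrow> 'v) \<Rightarrow> 'v set \<Rightarrow> bool" where
  "fin_dim_subspace scale V \<longleftrightarrow> (\<exists>B. finite B \<and> V = module.span scale B)"

text \<open>The cosets of the elements of \<open>B\<close> are pairwise distinct and form a basis of \<open>V / W\<close>.\<close>

definition quotient_basis ::
  "('f::field \<Rightarrow> 'v::ab_group_add \<Rightarrow> 'v) \<Rightarrow> 'v set \<Rightarrow> 'v set \<Rightarrow> 'v set \<Rightarrow> bool" where
  "quotient_basis scale V W B \<longleftrightarrow> B \<subseteq> V \<and>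
     (\<forall>T u. finite T \<and> T \<subseteq> B \<and> (\<Sum>b\<in>T. scale (u b) b) \<in> W \<longrightarrow> (\<forall>b\<in>T. u b = 0)) \<and>
     (\<forall>v\<in>V. \<exists>T u. finite T \<and> T \<subseteq> B \<and> v - (\<Sum>b\<in>T. scale (u b) b) \<in> W)"

definition quotient_dim ::
  "('f::field \<Rightarrow> 'v::ab_group_add \<Rightarrow> 'v) \<Rightarrow> 'v set \<Rightarrow> 'v set \<Rightarrow> nat" where
  "quotient_dim scale V W = card (SOME B. quotient_basis scale V W B)"


subsection \<open>Lie algebras\<close>

locale lie_algebra = vector_space scale
  for scale :: "'f::field \<Rightarrow> 'g::ab_group_add \<Rightarrow> 'g" +
  fixes bracket :: "'g \<Rightarrow> 'g \<Rightarrow> 'g"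
  assumes bracket_add_left: "bracket (x + y) z = bracket x z + bracket y z"
    and bracket_add_right: "bracket x (y + z) = bracket x y + bracket x z"
    and bracket_scale_left: "bracket (scale c x) y = scale c (bracket x y)"
    and bracket_scale_right: "bracket x (scale c y) = scale c (bracket x y)"
    and bracket_self: "bracket x x = 0"
    and jacobi: "bracket x (bracket y z) + bracket y (bracket z x) + bracket z (bracket x y) = 0"
begin

definition lie_ideal :: "'g set \<Rightarrow> bool" where
  "lie_ideal I \<longleftrightarrow> subspace I \<and> (\<forall>x. \<forall>y\<in>I. bracket x y \<in> I)"

primrec derived_series :: "'g set \<Rightarrow> nat \<Rightarrow> 'g set" where
  "derived_series I 0 = I"
| "derived_series I (Suc n) =
     span {bracket x y | x y. x \<in> derived_series I n \<and> y \<in> derived_series I n}"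

definition lie_solvable :: "'g set \<Rightarrow> bool" where
  "lie_solvable I \<longleftrightarrow> (\<exists>n. derived_series I n = {0})"

text \<open>The radical vanishes, i.e. \<open>0\<close> is the only solvable ideal.\<close>

definition semisimple :: bool where
  "semisimple \<longleftrightarrow> (\<forall>I. lie_ideal I \<and> lie_solvable I \<longrightarrow> I = {0})"

end


subsection \<open>Free associative algebras\<close>

datatype 'a free_monoid = Word (letters: "'a list")

instantiation free_monoid :: (type) monoid_add
begin

definition zero_free_monoid :: "'a free_monoid" where
  "0 = Word []"

definition plus_free_monoid :: "'a free_monoid \<Rightarrow> 'a free_monoid \<Rightarrow> 'a free_monoid" where
  "v + w = Word (letters v @ letters w)"

instance
  by standard (simp_all add: zero_free_monoid_def plus_free_monoid_def)

end

text \<open>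
  The multiplication of \<^typ>\<open>'g free_monoid \<Rightarrow>\<^sub>0 'f\<close> is convolution, so this type is the algebra
  of noncommutative polynomials over \<open>'f\<close> whose variables are the elements of \<open>'g\<close>.
\<close>

definition free_algebra :: "('g free_monoid \<Rightarrow>\<^sub>0 'f::field) ring" where
  "free_algebra = \<lparr>carrier = UNIV, mult = (*), one = 1, zero = 0, add = (+)\<rparr>"

lemma ring_free_algebra: "ring (free_algebra :: ('g free_monoid \<Rightarrow>\<^sub>0 'f::field) ring)"
proof (rule ringI)
  show "abelian_group (free_algebra :: ('g free_monoid \<Rightarrow>\<^sub>0 'f) ring)"
  proof (rule abelian_groupI)
    fix x :: "'g free_monoid \<Rightarrow>\<^sub>0 'f"
    show "\<exists>y\<in>carrier free_algebra. y \<oplus>\<^bsub>free_algebra\<^esub> x = \<zero>\<^bsub>free_algebra\<^esub>"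
      by (rule bexI [of _ "- x"]) (simp_all add: free_algebra_def)
  qed (simp_all add: free_algebra_def ac_simps)
  show "monoid (free_algebra :: ('g free_monoid \<Rightarrow>\<^sub>0 'f) ring)"
    by standard (simp_all add: free_algebra_def mult.assoc)
qed (simp_all add: free_algebra_def algebra_simps)

definition const :: "'f::field \<Rightarrow> 'g free_monoid \<Rightarrow>\<^sub>0 'f" where
  "const c = Poly_Mapping.single 0 c"

definition var :: "'g \<Rightarrow> 'g free_monoid \<Rightarrow>\<^sub>0 'f::field" where
  "var x = Poly_Mapping.single (Word [x]) 1"


subsection \<open>The universal enveloping algebra and its standard filtration\<close>

context lie_algebra
begin

text \<open>
  The first two sets of relations turn the free algebra on the set \<open>'g\<close> into the tensor algebra of
  the vector space \<open>'g\<close>.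
\<close>

definition enveloping_relations :: "('g free_monoid \<Rightarrow>\<^sub>0 'f) set" where
  "enveloping_relations =
     {var (x + y) - (var x + var y) | x y. True} \<union>
     {var (scale c x) - const c * var x | c x. True} \<union>
     {var x * var y - var y * var x - var (bracket x y) | x y. True}"

definition enveloping_ideal :: "('g free_monoid \<Rightarrow>\<^sub>0 'f) set" where
  "enveloping_ideal = genideal free_algebra enveloping_relations"

definition enveloping_algebra :: "('g free_monoid \<Rightarrow>\<^sub>0 'f) set ring" where
  "enveloping_algebra = free_algebra Quot enveloping_ideal"

definition enveloping_class :: "('g free_monoid \<Rightarrow>\<^sub>0 'f) \<Rightarrow> ('g free_monoid \<Rightarrow>\<^sub>0 'f) set" where
  "enveloping_class a = enveloping_ideal +>\<^bsub>free_algebra\<^esub> a"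

text \<open>\<open>U\<^sub>k\<close> is spanned by the products of at most \<open>k\<close> elements of the Lie algebra.\<close>

definition enveloping_filtration :: "nat \<Rightarrow> ('g free_monoid \<Rightarrow>\<^sub>0 'f) set set" where
  "enveloping_filtration k =
     enveloping_class ` {a. \<forall>w\<in>Poly_Mapping.keys a. length (letters w) \<le> k}"

lemma enveloping_ideal: "ideal enveloping_ideal free_algebra"
  unfolding enveloping_ideal_def
  by (rule ring.genideal_ideal [OF ring_free_algebra]) (simp add: free_algebra_def)

lemma ring_enveloping_algebra: "ring enveloping_algebra"
  unfolding enveloping_algebra_def by (rule ideal.quotient_is_ring [OF enveloping_ideal])

lemma enveloping_class_ring_hom: "enveloping_class \<in> ring_hom free_algebra enveloping_algebra"
  using ideal.rcos_ring_hom [OF enveloping_ideal]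
  by (simp add: enveloping_class_def [abs_def] enveloping_algebra_def)

end


subsection \<open>Modules over the universal enveloping algebra\<close>

locale left_module = ring R for R (structure) +
  fixes act :: "'r \<Rightarrow> 'm::ab_group_add \<Rightarrow> 'm"
  assumes act_add_right: "r \<in> carrier R \<Longrightarrow> act r (m + n) = act r m + act r n"
    and act_add_left: "r \<in> carrier R \<Longrightarrow> s \<in> carrier R \<Longrightarrow> act (r \<oplus> s) m = act r m + act s m"
    and act_mult: "r \<in> carrier R \<Longrightarrow> s \<in> carrier R \<Longrightarrow> act (r \<otimes> s) m = act r (act s m)"
    and act_one: "act \<one> m = m"

locale enveloping_module = lie_algebra scale bracket +
  U: left_module "lie_algebra.enveloping_algebra scale bracket" act
  for scale :: "'f::field \<Rightarrow> 'g::ab_group_add \<Rightarrow> 'g" and bracket :: "'g \<Rightarrow> 'g \<Rightarrow> 'g"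
    and act :: "('g free_monoid \<Rightarrow>\<^sub>0 'f) set \<Rightarrow> 'm::ab_group_add \<Rightarrow> 'm"
begin

definition mscale :: "'f \<Rightarrow> 'm \<Rightarrow> 'm" where
  "mscale c m = act (enveloping_class (const c)) m"

sublocale M: vector_space mscale
proof
  have closed: "enveloping_class a \<in> carrier enveloping_algebra" for a
    using ring_hom_closed [OF enveloping_class_ring_hom] by (simp add: free_algebra_def)
  have add: "enveloping_class (a + b) = enveloping_class a \<oplus>\<^bsub>enveloping_algebra\<^esub> enveloping_class b" for a b
    using ring_hom_add [OF enveloping_class_ring_hom, of a b] by (simp add: free_algebra_def)
  have mult: "enveloping_class (a * b) = enveloping_class a \<otimes>\<^bsub>enveloping_algebra\<^esub> enveloping_class b" for a b
    using ring_hom_mult [OF enveloping_class_ring_hom, of a b] by (simp add: free_algebra_def)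
  have one: "enveloping_class 1 = \<one>\<^bsub>enveloping_algebra\<^esub>"
    using ring_hom_one [OF enveloping_class_ring_hom] by (simp add: free_algebra_def)
  show "mscale a (x + y) = mscale a x + mscale a y" for a x y
    unfolding mscale_def by (rule U.act_add_right [OF closed])
  show "mscale (a + b) x = mscale a x + mscale b x" for a b x
    by (simp add: mscale_def const_def single_add add U.act_add_left closed)
  have "const (a * b) = (const a * const b :: 'g free_monoid \<Rightarrow>\<^sub>0 'f)" for a b
    by (simp add: const_def mult_single)
  then show "mscale a (mscale b x) = mscale (a * b) x" for a b x
    by (simp add: mscale_def mult U.act_mult closed)
  show "mscale 1 x = x" for x
    by (simp add: mscale_def const_def one U.act_one)
qed

text \<open>The subspace \<open>A N\<close> of finite sums of products \<open>a n\<close>.\<close>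

definition act_span :: "('g free_monoid \<Rightarrow>\<^sub>0 'f) set set \<Rightarrow> 'm set \<Rightarrow> 'm set" where
  "act_span A N = M.span {act a n | a n. a \<in> A \<and> n \<in> N}"

definition generates :: "'m set \<Rightarrow> bool" where
  "generates N \<longleftrightarrow> act_span (carrier enveloping_algebra) N = UNIV"

definition finitely_generated :: bool where
  "finitely_generated \<longleftrightarrow> (\<exists>S. finite S \<and> generates S)"

definition module_filtration :: "'m set \<Rightarrow> nat \<Rightarrow> 'm set" where
  "module_filtration M0 k = act_span (enveloping_filtration k) M0"

text \<open>
  Integer-valued polynomials have rational coefficients. Only large \<open>k\<close> matter, so the truncated
  subtraction at \<open>k = 0\<close> is harmless.
\<close>

definition hilbert_polynomial :: "'m set \<Rightarrow> rat poly" where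
  "hilbert_polynomial M0 = (THE p. \<forall>\<^sub>F k in sequentially.
     poly p (of_nat k) =
       of_nat (quotient_dim mscale (module_filtration M0 k) (module_filtration M0 (k - 1))))"

end

end

theory Submission
  imports Defs "HOL-Library.Multiset_Order" "HOL-Library.Product_Lexorder"
begin

text \<open>
  Write \<open>M\<^sub>k = U\<^sub>k M\<^sub>0\<close>, let \<open>x\<^sub>0, \<dots>, x\<^sub>n\<^sub>-\<^sub>1\<close> span the Lie algebra and let \<open>g\<^sub>0, \<dots>, g\<^sub>r\<^sub>-\<^sub>1\<close> span
  \<open>M\<^sub>0\<close>. The proof has two halves: \<open>dim M\<^sub>k\<close> is eventually a polynomial \<open>P\<close> in \<open>k\<close>, and two such
  polynomials, belonging to \<open>M\<^sub>0\<close> and \<open>M\<^sub>0'\<close>, have the same degree and leading coefficient.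

  For the first half, a commutator of two \<open>x\<^sub>i\<close> is a linear combination of the \<open>x\<^sub>i\<close>, so a word of
  length \<open>k\<close> in the \<open>x\<^sub>i\<close> applied to \<open>g\<^sub>j\<close> depends, modulo \<open>M\<^sub>k\<^sub>-\<^sub>1\<close>, only on the multiset \<open>\<alpha>\<close> of its
  letters (\<open>apply_word_permute\<close>). Hence \<open>M\<^sub>k\<close> is spanned by the vectors \<open>x\<^sup>\<alpha> g\<^sub>j\<close> with \<open>|\<alpha>| \<le> k\<close>.
  Order the pairs \<open>(\<alpha>, j)\<close> first by degree, then by a monomial order, then by \<open>j\<close>, and call a
  pair standard if \<open>x\<^sup>\<alpha> g\<^sub>j\<close> is not a linear combination of the vectors of smaller pairs; then
  \<open>dim M\<^sub>k\<close> is the number of standard pairs of degree at most \<open>k\<close>. As in the theory of Groebner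
  bases, for each \<open>j\<close> the standard exponents are closed under passing to divisors
  (\<open>standard_add_mset\<close>), because multiplication by a letter respects the order up to terms of lower
  degree. The number of elements of degree \<open>k\<close> in such a down-set is eventually polynomial in
  \<open>k\<close> (\<open>eventually_polynomial_card_down_set\<close>). This goes by induction on the number of letters: slice
  the down-set by the exponent of the last letter; by Dickson's lemma the slices are eventually
  constant.

  For the second half, the subspaces \<open>M\<^sub>s'\<close> exhaust the module, so that \<open>M\<^sub>0 \<subseteq> M\<^sub>s'\<close> for some \<open>s\<close> and
  therefore \<open>M\<^sub>k \<subseteq> M\<^sub>k\<^sub>+\<^sub>s'\<close> for all \<open>k\<close>; symmetrically with the roles exchanged. So
  \<open>P(k) \<le> P'(k + s)\<close> and \<open>P'(k) \<le> P(k + t)\<close> for large \<open>k\<close>, which forces equal degrees and leading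
  coefficients. The Hilbert polynomial is \<open>P(x) - P(x - 1)\<close>, whose leading coefficient is determined
  by those two data.
\<close>

section \<open>Eventually polynomial functions\<close>

text \<open>The function agrees with some polynomial for all sufficiently large arguments.\<close>

definition eventually_polynomial :: "(nat \<Rightarrow> 'a::field_char_0) \<Rightarrow> bool" where
  "eventually_polynomial f \<longleftrightarrow> (\<exists>p. \<forall>\<^sub>F k in sequentially. poly p (of_nat k) = f k)"

lemma eventually_polynomial_const: "eventually_polynomial (\<lambda>k. c)"
  unfolding eventually_polynomial_def by (intro exI [of _ "[:c:]"]) simp

lemma eventually_polynomial_add:
  assumes "eventually_polynomial f" and "eventually_polynomial g"
  shows "eventually_polynomial (\<lambda>k. f k + g k)"
proof -
  obtain p q where "\<forall>\<^sub>F k in sequentially. poly p (of_nat k) = f k"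
    and "\<forall>\<^sub>F k in sequentially. poly q (of_nat k) = g k"
    using assms unfolding eventually_polynomial_def by blast
  then have "\<forall>\<^sub>F k in sequentially. poly (p + q) (of_nat k) = f k + g k"
    by eventually_elim simp
  then show ?thesis
    unfolding eventually_polynomial_def by blast
qed

lemma eventually_polynomial_sum:
  "(\<And>i. i \<in> I \<Longrightarrow> eventually_polynomial (f i)) \<Longrightarrow> eventually_polynomial (\<lambda>k. \<Sum>i\<in>I. f i k)"
  by (induction I rule: infinite_finite_induct)
    (simp_all add: eventually_polynomial_const eventually_polynomial_add)

lemma eventually_polynomial_cong:
  assumes "eventually_polynomial f" and "\<forall>\<^sub>F k in sequentially. f k = g k"
  shows "eventually_polynomial g"
proof -
  obtain p where "\<forall>\<^sub>F k in sequentially. poly p (of_nat k) = f k"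
    using assms(1) unfolding eventually_polynomial_def by blast
  with assms(2) have "\<forall>\<^sub>F k in sequentially. poly p (of_nat k) = g k"
    by eventually_elim simp
  then show ?thesis
    unfolding eventually_polynomial_def by blast
qed

lemma eventually_polynomial_shift:
  assumes "eventually_polynomial f"
  shows "eventually_polynomial (\<lambda>k. f (k - t))"
proof -
  obtain p N where p: "poly p (of_nat k) = f k" if "k \<ge> N" for k
    using assms unfolding eventually_polynomial_def eventually_sequentially by blast
  have "poly (pcompose p [:- of_nat t, 1:]) (of_nat k) = f (k - t)" if "k \<ge> N + t" for k
    using p [of "k - t"] that by (simp add: poly_pcompose of_nat_diff)
  then show ?thesis
    unfolding eventually_polynomial_def eventually_sequentially by blast
qed

text \<open>
  By the binomial theorem, \<open>(x + 1)\<^bsup>d+1\<^esup> - x\<^bsup>d+1\<^esup>\<close> equals \<open>(d + 1) x\<^sup>d\<close> plus monomials of lower degree, whose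
  antidifferences are known by induction.
\<close>

lemma monomial_antidifference:
  "\<exists>q :: 'a::field_char_0 poly. \<forall>x. poly q (x + 1) - poly q x = x ^ d"
proof (induction d rule: less_induct)
  case (less d)
  then obtain Q :: "nat \<Rightarrow> 'a poly"
    where Q: "\<And>i x. i < d \<Longrightarrow> poly (Q i) (x + 1) - poly (Q i) x = x ^ i"
    by metis
  define R where "R = monom 1 (Suc d) - (\<Sum>i<d. smult (of_nat (Suc d choose i)) (Q i))"
  have R: "poly R (x + 1) - poly R x = of_nat (Suc d) * x ^ d" for x
  proof -
    have "(x + 1) ^ Suc d = (\<Sum>i\<le>Suc d. of_nat (Suc d choose i) * x ^ i)"
      using binomial_ring [of x 1 "Suc d"] by simp
    also have "\<dots> = (\<Sum>i<d. of_nat (Suc d choose i) * x ^ i) + of_nat (Suc d) * x ^ d + x ^ Suc d"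
      by (simp add: lessThan_Suc_atMost [symmetric])
    also have "(\<Sum>i<d. of_nat (Suc d choose i) * x ^ i) =
        (\<Sum>i<d. of_nat (Suc d choose i) * (poly (Q i) (x + 1) - poly (Q i) x))"
      by (rule sum.cong) (simp_all add: Q)
    finally show ?thesis
      by (simp add: R_def poly_monom poly_sum right_diff_distrib sum_subtractf)
  qed
  have "of_nat (Suc d) \<noteq> (0::'a)"
    by (rule of_nat_neq_0)
  then have "poly (smult (inverse (of_nat (Suc d))) R) (x + 1)
      - poly (smult (inverse (of_nat (Suc d))) R) x = x ^ d" for x
    by (simp only: poly_smult right_diff_distrib [symmetric] R) (simp add: mult.assoc [symmetric])
  then show ?case
    by blast
qed

lemma polynomial_antidifference:
  fixes p :: "'a::field_char_0 poly"
  shows "\<exists>q. \<forall>x. poly q (x + 1) - poly q x = poly p x"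
proof -
  obtain Q :: "nat \<Rightarrow> 'a poly" where Q: "\<And>d x. poly (Q d) (x + 1) - poly (Q d) x = x ^ d"
    using monomial_antidifference by metis
  have "poly (\<Sum>i\<le>degree p. smult (coeff p i) (Q i)) (x + 1)
      - poly (\<Sum>i\<le>degree p. smult (coeff p i) (Q i)) x = poly p x" for x
  proof -
    have "poly (\<Sum>i\<le>degree p. smult (coeff p i) (Q i)) (x + 1)
        - poly (\<Sum>i\<le>degree p. smult (coeff p i) (Q i)) x
        = (\<Sum>i\<le>degree p. coeff p i * (poly (Q i) (x + 1) - poly (Q i) x))"
      by (simp add: poly_sum right_diff_distrib sum_subtractf)
    then show ?thesis
      by (simp add: Q poly_altdef [of p])
  qed
  then show ?thesis
    by blast
qed

lemma eventually_polynomial_partial_sums: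
  fixes f :: "nat \<Rightarrow> 'a::field_char_0"
  assumes "eventually_polynomial f"
  shows "eventually_polynomial (\<lambda>k. \<Sum>i\<le>k. f i)"
proof -
  obtain p N where p: "poly p (of_nat k) = f k" if "k \<ge> N" for k
    using assms unfolding eventually_polynomial_def eventually_sequentially by blast
  obtain q where q: "poly q (x + 1) - poly q x = poly p x" for x
    using polynomial_antidifference by blast
  define c where "c = (\<Sum>i\<le>N. f i) - poly q (of_nat N + 1)"
  have "(\<Sum>i\<le>k. f i) = poly q (of_nat k + 1) + c" if "k \<ge> N" for k
    using that
  proof (induction k rule: dec_induct)
    case base
    show ?case by (simp add: c_def)
  next
    case (step k)
    then show ?case
      using p [of "Suc k"] q [of "of_nat (Suc k)"] by (simp add: algebra_simps)
  qed
  then have "poly (pcompose q [:1, 1:] + [:c:]) (of_nat k) = (\<Sum>i\<le>k. f i)" if "k \<ge> N" for k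
    using that by (simp add: poly_pcompose add.commute)
  then show ?thesis
    unfolding eventually_polynomial_def eventually_sequentially by blast
qed

section \<open>Comparing polynomials by their values at large natural numbers\<close>

lemma poly_eqI_sequentially:
  fixes p q :: "'a::field_char_0 poly"
  assumes "\<forall>\<^sub>F k in sequentially. poly p (of_nat k) = poly q (of_nat k)"
  shows "p = q"
proof (rule ccontr)
  assume "p \<noteq> q"
  then have "finite {x. poly (p - q) x = 0}"
    by (intro poly_roots_finite) simp
  moreover obtain N where "\<And>k. k \<ge> N \<Longrightarrow> poly p (of_nat k) = poly q (of_nat k)"
    using assms unfolding eventually_sequentially by blast
  then have "of_nat ` {N..} \<subseteq> {x. poly (p - q) x = 0}"
    by auto
  ultimately have "finite ((of_nat :: nat \<Rightarrow> 'a) ` {N..})"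
    by (rule rev_finite_subset)
  then show False
    by (simp add: finite_image_iff inj_on_def infinite_Ici)
qed

lemma eventually_pos_if_lead_coeff_pos:
  fixes p :: "'a::{field_char_0, archimedean_field} poly"
  assumes "lead_coeff p > 0"
  shows "\<forall>\<^sub>F k in sequentially. poly p (of_nat k) > 0"
proof -
  have "\<exists>c>0. \<forall>\<^sub>F k in sequentially. poly p (of_nat k) \<ge> c"
    using assms
  proof (induction p)
    case 0
    then show ?case by simp
  next
    case (pCons a p)
    show ?case
    proof (cases "p = 0")
      case True
      with pCons.prems show ?thesis
        by (intro exI [of _ a]) simp
    next
      case False
      with pCons.prems have "lead_coeff p > 0"
        by simp
      then obtain c where "c > 0" and c: "\<forall>\<^sub>F k in sequentially. poly p (of_nat k) \<ge> c"
        using pCons.IH by blast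
      obtain K :: nat where K: "(1 - a) / c \<le> of_nat K"
        using real_arch_simple by blast
      have "\<forall>\<^sub>F k in sequentially. poly (pCons a p) (of_nat k) \<ge> 1"
        using c eventually_ge_at_top [of K]
      proof eventually_elim
        case (elim k)
        have "1 - a \<le> of_nat K * c"
          using K \<open>c > 0\<close> by (simp add: pos_divide_le_eq)
        also have "\<dots> \<le> of_nat k * poly p (of_nat k)"
          using elim \<open>c > 0\<close> by (intro mult_mono) auto
        finally show ?case
          by (simp add: algebra_simps)
      qed
      then show ?thesis
        by (intro exI [of _ 1]) simp
    qed
  qed
  then obtain c where "c > 0" and "\<forall>\<^sub>F k in sequentially. poly p (of_nat k) \<ge> c"
    by blast
  from this(2) show ?thesis
    by eventually_elim (use \<open>c > 0\<close> in simp)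
qed

lemma lead_coeff_nonneg_if_eventually_nonneg:
  fixes p :: "'a::{field_char_0, archimedean_field} poly"
  assumes "\<forall>\<^sub>F k in sequentially. poly p (of_nat k) \<ge> 0"
  shows "lead_coeff p \<ge> 0"
proof (rule ccontr)
  assume "\<not> lead_coeff p \<ge> 0"
  then have "\<forall>\<^sub>F k in sequentially. poly (- p) (of_nat k) > 0"
    by (intro eventually_pos_if_lead_coeff_pos) simp
  with assms have "\<forall>\<^sub>F k in sequentially. False"
    by eventually_elim simp
  then show False
    by simp
qed

lemma pcompose_shift:
  fixes p :: "'a::field_char_0 poly"
  shows "degree (pcompose p [:s, 1:]) = degree p" "lead_coeff (pcompose p [:s, 1:]) = lead_coeff p"
  using lead_coeff_comp [of "[:s, 1:]" p] by (simp_all add: degree_pcompose)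

text \<open>
  A shift of the argument changes neither the degree nor the leading coefficient, so \<open>q(x + s) - p(x)\<close>
  has a nonnegative leading coefficient only if \<open>q\<close> dominates \<open>p\<close> in its leading term.
\<close>

lemma degree_lead_coeff_le_if_dominated:
  fixes p q :: "'a::{field_char_0, archimedean_field} poly"
  assumes nonneg: "\<forall>\<^sub>F k in sequentially. poly p (of_nat k) \<ge> 0"
    and le: "\<forall>\<^sub>F k in sequentially. poly p (of_nat k) \<le> poly q (of_nat (k + s))"
  shows "degree p \<le> degree q" and "degree p = degree q \<Longrightarrow> lead_coeff p \<le> lead_coeff q"
proof -
  define r where "r = pcompose q [:of_nat s, 1:]"
  have r: "degree r = degree q" "lead_coeff r = lead_coeff q"
    unfolding r_def by (rule pcompose_shift)+
  have "\<forall>\<^sub>F k in sequentially. poly (r - p) (of_nat k) \<ge> 0"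
    using le by eventually_elim (simp add: r_def poly_pcompose add.commute)
  then have diff: "lead_coeff (r - p) \<ge> 0"
    by (rule lead_coeff_nonneg_if_eventually_nonneg)
  have p: "lead_coeff p \<ge> 0"
    using nonneg by (rule lead_coeff_nonneg_if_eventually_nonneg)
  show "degree p \<le> degree q"
  proof (rule ccontr)
    assume less: "\<not> degree p \<le> degree q"
    then have "degree (r - p) = degree p"
      using degree_add_eq_right [of r "- p"] r by simp
    then have "lead_coeff (r - p) = - lead_coeff p"
      using less r by (simp add: coeff_eq_0)
    with diff p have "lead_coeff p = 0"
      by linarith
    with less show False
      by simp
  qed
  show "lead_coeff p \<le> lead_coeff q" if eq: "degree p = degree q"
  proof (rule ccontr)
    assume less: "\<not> lead_coeff p \<le> lead_coeff q"
    then have neg: "coeff (r - p) (degree p) < 0"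
      using r eq by simp
    then have "degree p \<le> degree (r - p)"
      by (intro le_degree) linarith
    moreover have "degree (r - p) \<le> degree p"
      using r eq by (intro degree_diff_le) auto
    ultimately have "lead_coeff (r - p) < 0"
      using neg by (metis antisym)
    with diff show False
      by linarith
  qed
qed

lemma coeff_backward_difference:
  fixes p :: "'a::field_char_0 poly"
  assumes "degree p = Suc d"
  shows "degree (p - pcompose p [:- 1, 1:]) = d"
    and "lead_coeff (p - pcompose p [:- 1, 1:]) = of_nat (Suc d) * lead_coeff p"
proof -
  \<comment> \<open>The claim for every \<open>q\<close>, in a form that survives induction on the coefficients; for constant
    \<open>q\<close> the truncated \<open>degree q - 1\<close> is \<open>0\<close> and both sides of the equation vanish.\<close>
  have *: "degree (q - pcompose q [:- 1, 1:]) \<le> degree q - 1 \<and>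
      coeff (q - pcompose q [:- 1, 1:]) (degree q - 1) = of_nat (degree q) * lead_coeff q"
    for q :: "'a poly"
  proof (induction q)
    case 0
    then show ?case by simp
  next
    case (pCons a q)
    show ?case
    proof (cases "q = 0")
      case False
      let ?D = "q - pcompose q [:- 1, 1:]"
      have eq: "pCons a q - pcompose (pCons a q) [:- 1, 1:] = pCons 0 ?D + pcompose q [:- 1, 1:]"
        by (simp add: pcompose_pCons algebra_simps)
      have D: "degree ?D \<le> degree q - 1"
        "coeff ?D (degree q - 1) = of_nat (degree q) * lead_coeff q"
        using pCons.IH by auto
      have "degree (pCons 0 ?D) \<le> degree q"
      proof (cases "degree q")
        case 0
        then obtain b where "q = [:b:]" by (rule degree_eq_zeroE)
        then show ?thesis by (simp add: pcompose_pCons)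
      next
        case (Suc n)
        then show ?thesis using D(1) degree_pCons_le [of 0 ?D] by linarith
      qed
      moreover have "coeff (pCons 0 ?D) (degree q) = of_nat (degree q) * lead_coeff q"
        using D(2) by (cases "degree q") simp_all
      moreover have "coeff (pcompose q [:- 1, 1:]) (degree q) = lead_coeff q"
        using pcompose_shift [of q "- 1"] by simp
      moreover have "degree (pcompose q [:- 1, 1:]) \<le> degree q"
        by (simp add: pcompose_shift(1))
      ultimately have "degree (pCons 0 ?D + pcompose q [:- 1, 1:]) \<le> degree q"
        and "coeff (pCons 0 ?D + pcompose q [:- 1, 1:]) (degree q)
          = of_nat (Suc (degree q)) * lead_coeff q"
        by (simp_all only: degree_add_le coeff_add of_nat_Suc distrib_right mult_1_left add.commute)
      moreover have "degree (pCons a q) = Suc (degree q)"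
        using False by simp
      ultimately show ?thesis
        unfolding eq by (simp only: diff_Suc_1 coeff_pCons_Suc)
    qed (simp add: pcompose_pCons)
  qed
  have c: "coeff (p - pcompose p [:- 1, 1:]) d = of_nat (Suc d) * lead_coeff p"
    using * [of p] assms by simp
  moreover have "lead_coeff p \<noteq> 0" "of_nat (Suc d) \<noteq> (0::'a)"
    using assms by (metis leading_coeff_0_iff degree_0 nat.distinct(1)) (rule of_nat_neq_0)
  ultimately have "coeff (p - pcompose p [:- 1, 1:]) d \<noteq> 0"
    by (simp del: of_nat_Suc)
  then have "degree (p - pcompose p [:- 1, 1:]) \<ge> d"
    by (rule le_degree)
  then show deg: "degree (p - pcompose p [:- 1, 1:]) = d"
    using * [of p] assms by simp
  show "lead_coeff (p - pcompose p [:- 1, 1:]) = of_nat (Suc d) * lead_coeff p"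
    using c unfolding deg .
qed

text \<open>
  If \<open>p\<close> is constant, then so is \<open>q\<close>, possibly with another value; both differences are then \<open>0\<close>.
\<close>

lemma lead_coeff_backward_difference_eq:
  fixes p q :: "'a::{field_char_0, archimedean_field} poly"
  assumes p: "\<forall>\<^sub>F k in sequentially. poly p (of_nat k) \<ge> 0"
    and q: "\<forall>\<^sub>F k in sequentially. poly q (of_nat k) \<ge> 0"
    and pq: "\<forall>\<^sub>F k in sequentially. poly p (of_nat k) \<le> poly q (of_nat (k + s))"
    and qp: "\<forall>\<^sub>F k in sequentially. poly q (of_nat k) \<le> poly p (of_nat (k + t))"
  shows "lead_coeff (p - pcompose p [:- 1, 1:]) = lead_coeff (q - pcompose q [:- 1, 1:])"
proof -
  have deg: "degree p = degree q"
    using degree_lead_coeff_le_if_dominated(1) [OF p pq]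
      degree_lead_coeff_le_if_dominated(1) [OF q qp] by (rule antisym)
  have lc: "lead_coeff p = lead_coeff q"
    using degree_lead_coeff_le_if_dominated(2) [OF p pq deg]
      degree_lead_coeff_le_if_dominated(2) [OF q qp deg [symmetric]] by (rule antisym)
  show ?thesis
  proof (cases "degree q")
    case 0
    with deg have "degree p = 0"
      by simp
    then obtain a where "p = [:a:]"
      by (rule degree_eq_zeroE)
    moreover obtain b where "q = [:b:]"
      using 0 by (rule degree_eq_zeroE)
    ultimately show ?thesis
      by (simp add: pcompose_pCons)
  next
    case (Suc d)
    with deg have "degree p = Suc d"
      by simp
    show ?thesis
      unfolding coeff_backward_difference(2) [OF Suc] lc
        coeff_backward_difference(2) [OF \<open>degree p = Suc d\<close>] ..
  qed
qed

section \<open>Down-sets of monomials\<close>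

lemma nat_seq_incseq_subseq:
  fixes f :: "nat \<Rightarrow> nat"
  shows "\<exists>r. strict_mono r \<and> incseq (\<lambda>i. f (r i))"
proof -
  obtain r where r: "strict_mono r" "monoseq (\<lambda>i. f (r i))"
    using seq_monosub [of f] by blast
  show ?thesis
  proof (cases "incseq (\<lambda>i. f (r i))")
    case True
    with r show ?thesis by blast
  next
    case False
    with r have dec: "decseq (\<lambda>i. f (r i))"
      by (simp add: monoseq_iff)
    \<comment> \<open>A decreasing sequence of natural numbers is constant once it has reached its minimum.\<close>
    define m where "m = (LEAST x. x \<in> range (\<lambda>i. f (r i)))"
    have "m \<in> range (\<lambda>i. f (r i))"
      unfolding m_def by (rule LeastI [of _ "f (r 0)"]) simp
    then obtain N where N: "f (r N) = m" by auto
    have min: "m \<le> f (r i)" for i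
      unfolding m_def by (rule Least_le) simp
    have const: "f (r i) = m" if "i \<ge> N" for i
      using decseqD [OF dec that] N min [of i] by simp
    have "strict_mono (\<lambda>i. r (i + N))"
      using r(1) by (simp add: strict_mono_def)
    moreover have "incseq (\<lambda>i. f (r (i + N)))"
      by (simp add: const incseq_def)
    ultimately show ?thesis by blast
  qed
qed

text \<open>
  Dickson's lemma in sequence form: every sequence of monomials in \<open>n\<close> variables has a subsequence
  whose exponents are all nondecreasing.
\<close>

lemma dickson_subseq:
  fixes f :: "nat \<Rightarrow> nat multiset"
  shows "\<exists>r. strict_mono r \<and> (\<forall>x<n. incseq (\<lambda>i. count (f (r i)) x))"
proof (induction n)
  case 0
  show ?case
    by (rule exI [of _ id]) (simp add: strict_mono_def)
next
  case (Suc n)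
  then obtain r where r: "strict_mono r" "\<And>x. x < n \<Longrightarrow> incseq (\<lambda>i. count (f (r i)) x)"
    by blast
  obtain s where s: "strict_mono s" "incseq (\<lambda>i. count (f (r (s i))) n)"
    using nat_seq_incseq_subseq [of "\<lambda>i. count (f (r i)) n"] by blast
  have "incseq (\<lambda>i. count (f (r (s i))) x)" if "x < n" for x
    using r(2) [OF that] strict_mono_mono [OF s(1)] by (simp add: incseq_def monoD)
  with s have "\<forall>x<Suc n. incseq (\<lambda>i. count (f (r (s i))) x)"
    by (auto simp: less_Suc_eq)
  moreover have "strict_mono (\<lambda>i. r (s i))"
    using r(1) s(1) by (simp add: strict_mono_def)
  ultimately show ?case
    by blast
qed

text \<open>
  A set of monomials in the variables \<open>0, \<dots>, n - 1\<close> that contains all divisors of its elements. A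
  monomial is encoded as the multiset of its variables, so that divisibility is \<open>\<subseteq>#\<close> and the degree
  is \<open>size\<close>.
\<close>

definition down_set :: "nat \<Rightarrow> nat multiset set \<Rightarrow> bool" where
  "down_set n S \<longleftrightarrow>
     (\<forall>\<alpha>\<in>S. set_mset \<alpha> \<subseteq> {..<n}) \<and> (\<forall>\<alpha>\<in>S. \<forall>\<beta>. \<beta> \<subseteq># \<alpha> \<longrightarrow> \<beta> \<in> S)"

text \<open>
  Otherwise there would be elements \<open>\<alpha>\<^sub>0, \<alpha>\<^sub>1, \<dots>\<close> each lost from the chain before the next one is
  chosen, and by Dickson's lemma an earlier one divides a later one, which contradicts closure
  under divisors.
\<close>

lemma down_set_chain_stabilizes:
  assumes down: "\<And>t. down_set n (S t)" and dec: "\<And>t. S (Suc t) \<subseteq> S t"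
  shows "\<exists>T. \<forall>t\<ge>T. S t = S T"
proof (rule ccontr)
  assume "\<not> ?thesis"
  then have ex: "\<exists>t\<ge>T. S t \<noteq> S T" for T by blast
  have anti: "S t' \<subseteq> S t" if "t \<le> t'" for t t'
    using lift_Suc_antimono_le [of S, OF dec that] .
  have "\<forall>T. \<exists>t>T. \<exists>\<alpha>. \<alpha> \<in> S T - S t"
  proof
    fix T
    obtain t where "t \<ge> T" "S t \<noteq> S T"
      using ex by blast
    moreover from this have "t > T"
      by (cases "t = T") auto
    ultimately show "\<exists>t>T. \<exists>\<alpha>. \<alpha> \<in> S T - S t"
      using anti [of T t] by blast
  qed
  then obtain nxt \<alpha> where nxt: "\<And>T. nxt T > T" "\<And>T. \<alpha> T \<in> S T - S (nxt T)"
    by metis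
  define u where "u i = (nxt ^^ i) 0" for i
  have u: "u (Suc i) = nxt (u i)" for i
    by (simp add: u_def)
  have "strict_mono u"
    by (simp add: strict_mono_Suc_iff u nxt)
  obtain r where r: "strict_mono r" "\<And>x. x < n \<Longrightarrow> incseq (\<lambda>i. count (\<alpha> (u (r i))) x)"
    using dickson_subseq [of n "\<lambda>i. \<alpha> (u i)"] by blast
  have sub: "\<alpha> (u (r 0)) \<subseteq># \<alpha> (u (r 1))"
  proof (rule mset_subset_eqI)
    fix x
    show "count (\<alpha> (u (r 0))) x \<le> count (\<alpha> (u (r 1))) x"
    proof (cases "x < n")
      case True
      then show ?thesis using r(2) by (simp add: incseq_def)
    next
      case False
      with down nxt(2) have "x \<notin># \<alpha> (u (r 0))"
        unfolding down_set_def by blast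
      then show ?thesis by (simp add: not_in_iff)
    qed
  qed
  have "Suc (r 0) \<le> r 1"
    using r(1) by (simp add: strict_mono_def Suc_le_eq)
  then have "u (Suc (r 0)) \<le> u (r 1)"
    using \<open>strict_mono u\<close> by (simp add: strict_mono_less_eq)
  then have "\<alpha> (u (r 1)) \<in> S (nxt (u (r 0)))"
    using anti nxt(2) unfolding u by blast
  with sub down have "\<alpha> (u (r 0)) \<in> S (nxt (u (r 0)))"
    unfolding down_set_def by blast
  with nxt(2) show False by blast
qed

lemma finite_multisets_size: "finite {\<alpha>. set_mset \<alpha> \<subseteq> {..<n::nat} \<and> size \<alpha> = k}"
  using finite_multisets_of_size [of "{..<n}" k] by (simp add: multisets_of_size_def)

lemma finite_down_set_size:
  "down_set n S \<Longrightarrow> finite {\<alpha>\<in>S. size \<alpha> = k}"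
  by (rule finite_subset [OF _ finite_multisets_size [of n k]]) (auto simp: down_set_def)

lemma card_down_set_slices:
  assumes "down_set (Suc n) S"
  defines "slice \<equiv> \<lambda>t. {\<beta>. set_mset \<beta> \<subseteq> {..<n} \<and> \<beta> + replicate_mset t n \<in> S}"
  shows "card {\<alpha>\<in>S. size \<alpha> = k} = (\<Sum>t\<le>k. card {\<beta>\<in>slice t. size \<beta> = k - t})"
proof -
  define piece where "piece t = (\<lambda>\<beta>. \<beta> + replicate_mset t n) ` {\<beta>\<in>slice t. size \<beta> = k - t}" for t
  have "{\<alpha>\<in>S. size \<alpha> = k} = (\<Union>t\<le>k. piece t)"
  proof (intro equalityI subsetI)
    fix \<alpha> assume "\<alpha> \<in> {\<alpha>\<in>S. size \<alpha> = k}"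
    then have \<alpha>: "\<alpha> \<in> S" "size \<alpha> = k" by auto
    define t where "t = count \<alpha> n"
    define \<beta> where "\<beta> = filter_mset (\<lambda>x. x \<noteq> n) \<alpha>"
    have split: "\<alpha> = \<beta> + replicate_mset t n"
      unfolding \<beta>_def t_def by (auto intro!: multiset_eqI)
    have "set_mset \<alpha> \<subseteq> {..<Suc n}"
      using assms(1) \<alpha>(1) by (auto simp: down_set_def)
    then have "set_mset \<beta> \<subseteq> {..<n}"
      by (auto simp: \<beta>_def less_Suc_eq)
    then have "\<beta> \<in> slice t"
      using split \<alpha>(1) by (simp add: slice_def)
    moreover have "size \<beta> + t = k"
      using \<alpha>(2) by (subst (asm) split) simp
    ultimately show "\<alpha> \<in> (\<Union>t\<le>k. piece t)"
      using split unfolding piece_def by (intro UN_I [of t]) auto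
  qed (auto simp: piece_def slice_def)
  moreover have "piece t \<inter> piece t' = {}" if "t \<noteq> t'" for t t'
  proof -
    have "count \<alpha> n = t" if "\<alpha> \<in> piece t" for \<alpha> t
      using that by (auto simp: piece_def slice_def count_eq_zero_iff)
    with that show ?thesis by blast
  qed
  moreover have "finite (piece t)" for t
    unfolding piece_def
    by (intro finite_imageI finite_subset [OF _ finite_multisets_size [of n "k - t"]])
      (auto simp: slice_def)
  ultimately have "card {\<alpha>\<in>S. size \<alpha> = k} = (\<Sum>t\<le>k. card (piece t))"
    using card_UN_disjoint [of "{..k}" piece] by simp
  moreover have "card (piece t) = card {\<beta>\<in>slice t. size \<beta> = k - t}" for t
    unfolding piece_def by (rule card_image) (simp add: inj_on_def)
  ultimately show ?thesis by simp
qed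

text \<open>
  If the slices by the exponent \<open>t\<close> of the last variable are constant from \<open>t = T\<close> on, then the count
  in degree \<open>k\<close> is a sum of \<open>T\<close> shifted counts in one variable less and of a partial sum of one more
  such count.
\<close>

lemma eventually_polynomial_card_down_set:
  "down_set n S \<Longrightarrow>
    eventually_polynomial (\<lambda>k. of_nat (card {\<alpha>\<in>S. size \<alpha> = k}) :: 'a::field_char_0)"
proof (induction n arbitrary: S)
  case 0
  then have "S \<subseteq> {{#}}"
    by (auto simp: down_set_def)
  then have "card {\<alpha>\<in>S. size \<alpha> = k} = 0" if "k > 0" for k
    using that by (subst card_eq_0_iff) auto
  then have "\<forall>\<^sub>F k in sequentially. (0::'a) = of_nat (card {\<alpha>\<in>S. size \<alpha> = k})"
    by (intro eventually_sequentiallyI [of 1]) simp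
  then show ?case
    by (rule eventually_polynomial_cong [OF eventually_polynomial_const])
next
  case (Suc n)
  define slice where "slice t = {\<beta>. set_mset \<beta> \<subseteq> {..<n} \<and> \<beta> + replicate_mset t n \<in> S}" for t
  define h where "h t k = (of_nat (card {\<beta>\<in>slice t. size \<beta> = k}) :: 'a)" for t k
  have closed: "\<beta> \<in> S" if "\<alpha> \<in> S" "\<beta> \<subseteq># \<alpha>" for \<alpha> \<beta>
    using Suc.prems that unfolding down_set_def by blast
  have down: "down_set n (slice t)" for t
    unfolding down_set_def
  proof (intro conjI ballI allI impI)
    fix \<alpha> \<beta> assume "\<alpha> \<in> slice t" and "\<beta> \<subseteq># \<alpha>"
    then have "\<beta> + replicate_mset t n \<in> S"
      by - (rule closed [of "\<alpha> + replicate_mset t n"], simp_all add: slice_def)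
    with \<open>\<alpha> \<in> slice t\<close> set_mset_mono [OF \<open>\<beta> \<subseteq># \<alpha>\<close>] show "\<beta> \<in> slice t"
      by (auto simp: slice_def)
  qed (simp add: slice_def)
  have "slice (Suc t) \<subseteq> slice t" for t
  proof
    fix \<beta> assume "\<beta> \<in> slice (Suc t)"
    moreover from this have "\<beta> + replicate_mset t n \<in> S"
      by - (rule closed [of "\<beta> + replicate_mset (Suc t) n"], simp_all add: slice_def)
    ultimately show "\<beta> \<in> slice t"
      by (simp add: slice_def)
  qed
  then have "\<exists>T. \<forall>t\<ge>T. slice t = slice T"
    by (rule down_set_chain_stabilizes [OF down])
  then obtain T where T: "\<forall>t\<ge>T. slice t = slice T" ..
  have poly_h: "eventually_polynomial (h t)" for t
    using Suc.IH [OF down [of t]] unfolding h_def .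
  have "eventually_polynomial (\<lambda>k. \<Sum>t<T. h t (k - t))"
    by (rule eventually_polynomial_sum) (rule eventually_polynomial_shift [OF poly_h])
  moreover have "eventually_polynomial (\<lambda>k. \<Sum>j\<le>k - T. h T j)"
    by (rule eventually_polynomial_shift [OF eventually_polynomial_partial_sums [OF poly_h]])
  ultimately have "eventually_polynomial (\<lambda>k. (\<Sum>t<T. h t (k - t)) + (\<Sum>j\<le>k - T. h T j))"
    by (rule eventually_polynomial_add)
  moreover have "(\<Sum>t<T. h t (k - t)) + (\<Sum>j\<le>k - T. h T j) = of_nat (card {\<alpha>\<in>S. size \<alpha> = k})"
    if "k \<ge> T" for k
  proof -
    have "of_nat (card {\<alpha>\<in>S. size \<alpha> = k}) = (\<Sum>t\<le>k. h t (k - t))"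
      using card_down_set_slices [OF Suc.prems, of k] unfolding h_def slice_def by simp
    also have "{..k} = {..<T} \<union> {T..k}"
      using that by auto
    also have "(\<Sum>t\<in>{..<T} \<union> {T..k}. h t (k - t)) = (\<Sum>t<T. h t (k - t)) + (\<Sum>t=T..k. h t (k - t))"
      by (rule sum.union_disjoint) auto
    also have "(\<Sum>t=T..k. h t (k - t)) = (\<Sum>t=T..k. h T (k - t))"
    proof (rule sum.cong)
      fix t assume "t \<in> {T..k}"
      with T have "slice t = slice T"
        by (meson atLeastAtMost_iff)
      then show "h t (k - t) = h T (k - t)"
        by (simp only: h_def)
    qed simp
    also have "\<dots> = (\<Sum>j\<le>k - T. h T j)"
      by (rule sum.reindex_bij_witness [of _ "\<lambda>j. k - j" "\<lambda>t. k - t"])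
        (use that in auto)
    finally show ?thesis ..
  qed
  ultimately show ?case
    by (rule eventually_polynomial_cong [OF _ eventually_sequentiallyI])
qed

section \<open>Dimensions of spans and quotients\<close>

context vector_space
begin

lemma dim_insert_finite:
  assumes "finite A"
  shows "dim (insert a A) = (if a \<in> span A then dim A else Suc (dim A))"
proof (cases "a \<in> span A")
  case True
  then show ?thesis
    using span_eq_dim [OF span_redundant] by simp
next
  case False
  obtain B where B: "B \<subseteq> A" "independent B" "A \<subseteq> span B" "card B = dim A"
    by (rule basis_exists)
  have span: "span B = span A"
    using B(1,3) span_eq span_superset by blast
  have "dim (insert a A) = card (insert a B)"
  proof (rule dim_eq_card)
    show "span (insert a B) = span (insert a A)"
      by (simp add: span_insert span)
    show "independent (insert a B)"
      using B(2) False span by (intro independent_insertI) simp_all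
  qed
  moreover have "a \<notin> B"
    using False B(1) span_base by blast
  moreover have "finite B"
    using B(1) assms by (rule finite_subset)
  ultimately show ?thesis
    using False B(4) by simp
qed

lemma dim_mono_finite:
  assumes "S \<subseteq> span T" and "T \<subseteq> span F" and "finite F"
  shows "dim S \<le> dim T"
proof -
  obtain B where B: "independent B" "B \<subseteq> T" "T \<subseteq> span B" "card B = dim T"
    by (rule basis_exists)
  have "finite B"
    using independent_span_bound [OF assms(3) B(1)] B(2) assms(2) by blast
  moreover have "S \<subseteq> span B"
    using assms(1) span_minimal [OF B(3) subspace_span] by blast
  ultimately show ?thesis
    using dim_le_card B(4) by metis
qed

text \<open>
  Counting the vectors of a finite ordered family that do not lie in the span of their
  predecessors.
\<close>

lemma dim_eq_card_standard:
  fixes v :: "'i::linorder \<Rightarrow> 'b"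
  assumes "finite J"
  shows "dim (v ` J) = card {j\<in>J. v j \<notin> span (v ` {i\<in>J. i < j})}"
  using assms
proof (induction J rule: finite_linorder_max_induct)
  case empty
  show ?case
    using dim_eq_card [OF refl independent_empty] by simp
next
  case (insert b J)
  have "{i \<in> insert b J. i < j} = {i \<in> J. i < j}" if "j \<in> J" for j
    using insert.hyps that by auto
  moreover have "{i \<in> insert b J. i < b} = J"
    using insert.hyps by auto
  ultimately have "{j \<in> insert b J. v j \<notin> span (v ` {i \<in> insert b J. i < j})} =
      (if v b \<in> span (v ` J) then {} else {b}) \<union> {j\<in>J. v j \<notin> span (v ` {i\<in>J. i < j})}"
    by auto
  moreover have "b \<notin> J"
    using insert.hyps by auto
  ultimately show ?case
    using insert by (simp add: dim_insert_finite)
qed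

lemma dim_eq_add_card_quotient_basis:
  assumes V: "subspace V" "V \<subseteq> span F" "finite F" and W: "subspace W" "W \<subseteq> V"
    and B: "quotient_basis scale V W B"
  shows "dim V = dim W + card B"
proof -
  have indep: "\<forall>b\<in>T. u b = 0" if "finite T" "T \<subseteq> B" "(\<Sum>b\<in>T. scale (u b) b) \<in> W" for T u
    using B that unfolding quotient_basis_def by simp
  have gen: "\<exists>T u. finite T \<and> T \<subseteq> B \<and> v - (\<Sum>b\<in>T. scale (u b) b) \<in> W" if "v \<in> V" for v
    using B that unfolding quotient_basis_def by simp
  have "B \<subseteq> V"
    using B unfolding quotient_basis_def by simp
  obtain A where A: "A \<subseteq> W" "independent A" "W \<subseteq> span A" "card A = dim W"
    by (rule basis_exists)
  have spanA: "span A = W"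
    using A W(1) by (simp add: span_subspace)
  have disj: "A \<inter> B = {}"
  proof (rule ccontr)
    assume "A \<inter> B \<noteq> {}"
    then obtain b where "b \<in> A" "b \<in> B" by blast
    with indep [of "{b}" "\<lambda>_. 1"] A(1) show False by auto
  qed
  have "independent (A \<union> B)"
    unfolding independent_explicit_module
  proof (intro allI impI)
    fix T u b
    assume T: "finite T" "T \<subseteq> A \<union> B" "(\<Sum>x\<in>T. scale (u x) x) = 0" "b \<in> T"
    have "T = (T \<inter> A) \<union> (T \<inter> B)"
      using T(2) by blast
    then have "(\<Sum>x\<in>T. scale (u x) x) = (\<Sum>x\<in>T \<inter> A. scale (u x) x) + (\<Sum>x\<in>T \<inter> B. scale (u x) x)"
      using sum.union_disjoint [of "T \<inter> A" "T \<inter> B" "\<lambda>x. scale (u x) x"] T(1) disj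
      by (simp add: disjoint_iff)
    then have eq: "(\<Sum>x\<in>T \<inter> B. scale (u x) x) = - (\<Sum>x\<in>T \<inter> A. scale (u x) x)"
      using T(3) by (simp add: eq_neg_iff_add_eq_0 add.commute)
    have "(\<Sum>x\<in>T \<inter> A. scale (u x) x) \<in> span A"
      by (intro span_sum span_scale span_base) blast
    then have "(\<Sum>x\<in>T \<inter> B. scale (u x) x) \<in> W"
      unfolding eq by (simp add: span_neg flip: spanA)
    then have uB: "\<forall>x\<in>T \<inter> B. u x = 0"
      using T(1) by (intro indep) auto
    then have "(\<Sum>x\<in>T \<inter> A. scale (u x) x) = 0"
      using eq by simp
    then have "\<forall>x\<in>T \<inter> A. u x = 0"
      using A(2) T(1) unfolding dependent_explicit by blast
    with uB T(2,4) show "u b = 0" by blast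
  qed
  moreover have "A \<union> B \<subseteq> V"
    using A(1) W(2) \<open>B \<subseteq> V\<close> by blast
  moreover have "V \<subseteq> span (A \<union> B)"
  proof
    fix v assume "v \<in> V"
    then obtain T u where T: "T \<subseteq> B" "v - (\<Sum>b\<in>T. scale (u b) b) \<in> W"
      using gen by blast
    have "v - (\<Sum>b\<in>T. scale (u b) b) \<in> span (A \<union> B)"
      using T(2) spanA span_mono [of A "A \<union> B"] by blast
    moreover have "(\<Sum>b\<in>T. scale (u b) b) \<in> span (A \<union> B)"
      using T(1) by (intro span_sum span_scale span_base) blast
    ultimately show "v \<in> span (A \<union> B)"
      using span_add by fastforce
  qed
  ultimately have "card (A \<union> B) = dim V"
    by (intro basis_card_eq_dim)
  moreover have "finite (A \<union> B)"
    using independent_span_bound [OF V(3) \<open>independent (A \<union> B)\<close>] \<open>A \<union> B \<subseteq> V\<close> V(2)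
    by (meson subset_trans)
  ultimately show ?thesis
    using disj A(4) by (simp add: card_Un_disjoint)
qed

lemma quotient_basis_exists:
  assumes V: "subspace V" and W: "subspace W" "W \<subseteq> V"
  shows "\<exists>B. quotient_basis scale V W B"
proof -
  obtain A where A: "A \<subseteq> W" "independent A" "W \<subseteq> span A" "card A = dim W"
    by (rule basis_exists)
  have spanA: "span A = W"
    using A W(1) by (simp add: span_subspace)
  obtain C where C: "A \<subseteq> C" "C \<subseteq> V" "independent C" "V \<subseteq> span C"
    using maximal_independent_subset_extend [OF subset_trans [OF A(1) W(2)] A(2)] .
  have "quotient_basis scale V W (C - A)"
    unfolding quotient_basis_def
  proof (intro conjI allI impI ballI)
    show "C - A \<subseteq> V"
      using C by blast
  next
    fix T u b
    assume T: "finite T \<and> T \<subseteq> C - A \<and> (\<Sum>b\<in>T. scale (u b) b) \<in> W" and "b \<in> T"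
    show "u b = 0"
    proof (rule ccontr)
      assume "u b \<noteq> 0"
      have "span A \<subseteq> span (C - {b})"
        using T \<open>b \<in> T\<close> C(1) by (intro span_mono) blast
      then have "(\<Sum>b\<in>T. scale (u b) b) \<in> span (C - {b})"
        using T spanA by blast
      moreover have "(\<Sum>x\<in>T - {b}. scale (u x) x) \<in> span (C - {b})"
        using T by (intro span_sum span_scale span_base) blast
      moreover have "(\<Sum>b\<in>T. scale (u b) b) - (\<Sum>x\<in>T - {b}. scale (u x) x) = scale (u b) b"
        using T \<open>b \<in> T\<close> sum.remove [of T b "\<lambda>b. scale (u b) b"] by simp
      ultimately have "scale (u b) b \<in> span (C - {b})"
        using span_diff by metis
      then have "scale (inverse (u b)) (scale (u b) b) \<in> span (C - {b})"
        by (rule span_scale)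
      then have "b \<in> span (C - {b})"
        using \<open>u b \<noteq> 0\<close> by simp
      with C(3) T \<open>b \<in> T\<close> show False
        unfolding dependent_def by blast
    qed
  next
    fix v assume "v \<in> V"
    then have "v \<in> span (A \<union> (C - A))"
      using C(1,4) by (metis Un_Diff_cancel subsetD sup.absorb2)
    then obtain x y where v: "v = x + y" "x \<in> span A" "y \<in> span (C - A)"
      unfolding span_Un by blast
    then obtain T u where "finite T" "T \<subseteq> C - A" "y = (\<Sum>b\<in>T. scale (u b) b)"
      unfolding span_explicit by auto
    moreover have "v - y \<in> W"
      using v(1,2) spanA by simp
    ultimately show "\<exists>T u. finite T \<and> T \<subseteq> C - A \<and> v - (\<Sum>b\<in>T. scale (u b) b) \<in> W"
      by blast
  qed
  then show ?thesis ..
qed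

lemma quotient_dim_add_dim:
  assumes "subspace V" "V \<subseteq> span F" "finite F" "subspace W" "W \<subseteq> V"
  shows "quotient_dim scale V W + dim W = dim V"
proof -
  have "quotient_basis scale V W (SOME B. quotient_basis scale V W B)"
    using quotient_basis_exists [OF assms(1,4,5)] by (rule someI_ex)
  then show ?thesis
    using dim_eq_add_card_quotient_basis [OF assms] by (simp add: quotient_dim_def)
qed

end

section \<open>Operators that commute up to lower order\<close>

text \<open>
  A vector space with operators \<open>X\<^sub>0, \<dots>, X\<^sub>n\<^sub>-\<^sub>1\<close> whose commutators are, pointwise, linear combinations of
  the operators themselves, and with vectors \<open>g\<^sub>0, \<dots>, g\<^sub>r\<^sub>-\<^sub>1\<close>. Only the indices below \<open>n\<close> and
  \<open>r\<close> matter, but linearity is assumed of every \<open>X\<^sub>a\<close>.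
\<close>

locale lie_operators = vector_space scale
  for scale :: "'f::field \<Rightarrow> 'v::ab_group_add \<Rightarrow> 'v" +
  fixes n r :: nat and X :: "nat \<Rightarrow> 'v \<Rightarrow> 'v" and g :: "nat \<Rightarrow> 'v"
  assumes X_add: "X a (x + y) = X a x + X a y"
    and X_scale: "X a (scale c x) = scale c (X a x)"
    and X_commutator: "a < n \<Longrightarrow> b < n \<Longrightarrow>
      X a (X b x) - X b (X a x) \<in> span ((\<lambda>c. X c x) ` {..<n})"
begin

text \<open>The composite of the operators named by the letters; the last letter acts first.\<close>

definition apply_word :: "nat list \<Rightarrow> 'v \<Rightarrow> 'v" where
  "apply_word w x = foldr X w x"

text \<open>The span of the results of applying words of length at most \<open>k\<close> to the vectors \<open>g\<^sub>j\<close>.\<close>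

definition filt :: "nat \<Rightarrow> 'v set" where
  "filt k = span {apply_word w (g j) | w j. set w \<subseteq> {..<n} \<and> length w \<le> k \<and> j < r}"

text \<open>The vector \<open>x\<^sup>\<alpha> g\<^sub>j\<close>, with the letters of \<open>\<alpha>\<close> applied in sorted order.\<close>

definition monomial_vector :: "nat multiset \<Rightarrow> nat \<Rightarrow> 'v" where
  "monomial_vector \<alpha> j = apply_word (sorted_list_of_multiset \<alpha>) (g j)"

lemma X_zero [simp]: "X a 0 = 0"
  using X_add [of a 0 0] by simp

lemma X_diff: "X a (x - y) = X a x - X a y"
  using X_add [of a "x - y" y] by (simp add: algebra_simps)

lemma X_span:
  assumes "x \<in> span S" and "\<And>s. s \<in> S \<Longrightarrow> X a s \<in> span T"
  shows "X a x \<in> span T"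
  using assms(1)
  by (induction rule: span_induct_alt) (simp_all add: X_add X_scale assms(2) span_zero span_add span_scale)

lemma apply_word_simps [simp]:
  "apply_word [] x = x" "apply_word (a # w) x = X a (apply_word w x)"
  by (simp_all add: apply_word_def)

lemma subspace_filt: "subspace (filt k)"
  unfolding filt_def by (rule subspace_span)

lemma filt_mono: "k \<le> l \<Longrightarrow> filt k \<subseteq> filt l"
  unfolding filt_def by (rule span_mono) (blast intro: order_trans)

lemma word_in_filt:
  "set w \<subseteq> {..<n} \<Longrightarrow> length w \<le> k \<Longrightarrow> j < r \<Longrightarrow> apply_word w (g j) \<in> filt k"
  unfolding filt_def by (rule span_base) blast

lemma X_filt:
  assumes "x \<in> filt k" and "a < n"
  shows "X a x \<in> filt (Suc k)"
  using assms(1) unfolding filt_def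
proof (rule X_span)
  fix s assume "s \<in> {apply_word w (g j) | w j. set w \<subseteq> {..<n} \<and> length w \<le> k \<and> j < r}"
  then obtain w j where "s = apply_word w (g j)" "set w \<subseteq> {..<n}" "length w \<le> k" "j < r"
    by blast
  then show "X a s \<in> span {apply_word w (g j) | w j. set w \<subseteq> {..<n} \<and> length w \<le> Suc k \<and> j < r}"
    using \<open>a < n\<close> word_in_filt [of "a # w" "Suc k" j] unfolding filt_def by simp
qed

lemma move_letter_to_front:
  assumes "set (u @ a # v) \<subseteq> {..<n}" and "j < r"
  shows "apply_word (u @ a # v) (g j) - apply_word (a # u @ v) (g j) \<in> filt (length u + length v)"
  using assms(1)
proof (induction u)
  case Nil
  show ?case
    using subspace_0 [OF subspace_filt] by simp
next
  case (Cons b u)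
  let ?y = "apply_word (u @ v) (g j)"
  have ab: "a < n" "b < n" and uv: "set (u @ v) \<subseteq> {..<n}"
    using Cons.prems by auto
  have y: "?y \<in> filt (length u + length v)"
    using uv \<open>j < r\<close> by (intro word_in_filt) auto
  have "apply_word (u @ a # v) (g j) - X a ?y \<in> filt (length u + length v)"
    using Cons by simp
  then have "X b (apply_word (u @ a # v) (g j) - X a ?y) \<in> filt (length (b # u) + length v)"
    using X_filt ab by simp
  moreover have "(\<lambda>c. X c ?y) ` {..<n} \<subseteq> filt (length (b # u) + length v)"
    using X_filt [OF y] by auto
  then have "X b (X a ?y) - X a (X b ?y) \<in> filt (length (b # u) + length v)"
    using X_commutator [OF ab(2,1), of ?y] span_minimal [OF _ subspace_filt] by blast
  ultimately have "X b (apply_word (u @ a # v) (g j) - X a ?y) + (X b (X a ?y) - X a (X b ?y))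
      \<in> filt (length (b # u) + length v)"
    by (rule subspace_add [OF subspace_filt])
  then show ?case
    by (simp add: X_diff)
qed

text \<open>
  The weak half of the Poincare-Birkhoff-Witt theorem: reordering the letters of a word costs only
  words of smaller length. For the empty word, the truncated \<open>length w - 1\<close> is harmless, since the
  difference is \<open>0\<close>.
\<close>

lemma apply_word_permute:
  assumes "mset w = mset w'" and "set w \<subseteq> {..<n}" and "j < r"
  shows "apply_word w (g j) - apply_word w' (g j) \<in> filt (length w - 1)"
  using assms(1,2)
proof (induction w arbitrary: w')
  case Nil
  then show ?case
    using subspace_0 [OF subspace_filt] by simp
next
  case (Cons a w)
  then have "a \<in> set w'"
    by (metis list.set_intros(1) set_mset_mset)
  then obtain u v where w': "w' = u @ a # v"
    by (meson split_list)
  have mset: "mset w = mset (u @ v)"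
    using Cons.prems(1) w' by simp
  then have len: "length w = length u + length v"
    by (metis length_append size_mset)
  have set': "set w' \<subseteq> {..<n}"
    using Cons.prems by (metis set_mset_mset)
  have "X a (apply_word w (g j) - apply_word (u @ v) (g j)) \<in> filt (length w)"
  proof (cases w)
    case Nil
    with len show ?thesis
      using subspace_0 [OF subspace_filt] by simp
  next
    case (Cons c w2)
    have "apply_word w (g j) - apply_word (u @ v) (g j) \<in> filt (length w - 1)"
      using Cons.IH [OF mset] Cons.prems by simp
    then show ?thesis
      using X_filt [of _ "length w - 1" a] Cons.prems \<open>w = c # w2\<close> by simp
  qed
  moreover have "apply_word w' (g j) - apply_word (a # u @ v) (g j) \<in> filt (length w)"
    using move_letter_to_front [OF _ \<open>j < r\<close>, of u a v] set' w' len by simp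
  ultimately have "X a (apply_word w (g j) - apply_word (u @ v) (g j))
      - (apply_word w' (g j) - apply_word (a # u @ v) (g j)) \<in> filt (length w)"
    by (rule subspace_diff [OF subspace_filt])
  then show ?case
    by (simp add: X_diff)
qed

lemma monomial_vector_in_filt:
  "set_mset \<alpha> \<subseteq> {..<n} \<Longrightarrow> size \<alpha> \<le> k \<Longrightarrow> j < r \<Longrightarrow> monomial_vector \<alpha> j \<in> filt k"
  unfolding monomial_vector_def
  by (rule word_in_filt) (simp_all flip: size_mset)

lemma X_monomial_vector:
  assumes "set_mset \<alpha> \<subseteq> {..<n}" and "a < n" and "j < r"
  shows "X a (monomial_vector \<alpha> j) - monomial_vector (add_mset a \<alpha>) j \<in> filt (size \<alpha>)"
  using apply_word_permute [of "a # sorted_list_of_multiset \<alpha>" "sorted_list_of_multiset (add_mset a \<alpha>)" j]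
    assms
  by (simp add: monomial_vector_def del: sorted_list_of_multiset_insert flip: size_mset)

text \<open>
  The index of \<open>x\<^sup>\<alpha> g\<^sub>j\<close> carries the redundant degree in first position. The lexicographic order on
  triples then compares the degrees first, next the monomials in the multiset order, which is a
  total order compatible with multiplication, and finally the generators.
\<close>

definition exponents :: "(nat \<times> nat multiset \<times> nat) set" where
  "exponents = {(size \<alpha>, \<alpha>, j) | \<alpha> j. set_mset \<alpha> \<subseteq> {..<n} \<and> j < r}"

text \<open>The vector with a given index.\<close>

definition vector_at :: "nat \<times> nat multiset \<times> nat \<Rightarrow> 'v" where
  "vector_at = (\<lambda>(s, \<alpha>, j). monomial_vector \<alpha> j)"

lemma exponents_iff [simp]:
  "(s, \<alpha>, j) \<in> exponents \<longleftrightarrow> s = size \<alpha> \<and> set_mset \<alpha> \<subseteq> {..<n} \<and> j < r"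
  by (auto simp: exponents_def)

lemma filt_eq_span_monomials: "filt k = span (vector_at ` {p\<in>exponents. fst p \<le> k})"
proof
  show "span (vector_at ` {p\<in>exponents. fst p \<le> k}) \<subseteq> filt k"
    by (intro span_minimal subspace_filt) (auto simp: exponents_def vector_at_def intro: monomial_vector_in_filt)
  have monomial_base: "monomial_vector \<alpha> j \<in> span (vector_at ` {p\<in>exponents. fst p \<le> k})"
    if "set_mset \<alpha> \<subseteq> {..<n}" "size \<alpha> \<le> k" "j < r" for \<alpha> j k
    using that by (intro span_base image_eqI [of _ _ "(size \<alpha>, \<alpha>, j)"]) (auto simp: vector_at_def)
  show "filt k \<subseteq> span (vector_at ` {p\<in>exponents. fst p \<le> k})"
  proof (induction k rule: less_induct)
    case (less k)
    have "apply_word w (g j) \<in> span (vector_at ` {p\<in>exponents. fst p \<le> k})"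
      if w: "set w \<subseteq> {..<n}" "length w \<le> k" "j < r" for w j
    proof (cases w)
      case Nil
      then show ?thesis
        using monomial_base [of "{#}" k j] w by (simp add: monomial_vector_def)
    next
      case (Cons a u)
      have "apply_word w (g j) - monomial_vector (mset w) j \<in> filt (length w - 1)"
        unfolding monomial_vector_def using w by (intro apply_word_permute) simp_all
      also have "\<dots> \<subseteq> span (vector_at ` {p\<in>exponents. fst p \<le> length w - 1})"
        using w Cons by (intro less.IH) simp
      also have "\<dots> \<subseteq> span (vector_at ` {p\<in>exponents. fst p \<le> k})"
        using w by (intro span_mono) auto
      finally have "apply_word w (g j) - monomial_vector (mset w) j + monomial_vector (mset w) j
          \<in> span (vector_at ` {p\<in>exponents. fst p \<le> k})"
        using w by (intro span_add monomial_base) auto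
      then show ?thesis by simp
    qed
    then show ?case
      unfolding filt_def by (intro span_minimal subspace_span) blast
  qed
qed

lemma finite_exponents: "finite {p\<in>exponents. fst p \<le> k}"
proof (rule finite_subset)
  show "{p\<in>exponents. fst p \<le> k} \<subseteq>
      {..k} \<times> (\<Union>s\<le>k. {\<alpha>. set_mset \<alpha> \<subseteq> {..<n} \<and> size \<alpha> = s}) \<times> {..<r}"
    by (auto simp: exponents_def)
  show "finite ({..k} \<times> (\<Union>s\<le>k. {\<alpha>. set_mset \<alpha> \<subseteq> {..<n} \<and> size \<alpha> = s}) \<times> {..<r})"
    by (intro finite_cartesian_product finite_UN_I finite_multisets_size) simp_all
qed

text \<open>The exponents \<open>\<alpha>\<close> for which \<open>x\<^sup>\<alpha> g\<^sub>j\<close> is not in the span of the vectors of smaller index.\<close>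

definition standard :: "nat \<Rightarrow> nat multiset set" where
  "standard j = {\<alpha>. set_mset \<alpha> \<subseteq> {..<n} \<and>
     monomial_vector \<alpha> j \<notin> span (vector_at ` {q\<in>exponents. q < (size \<alpha>, \<alpha>, j)})}"

text \<open>
  Apply \<open>X\<^sub>a\<close> to an expression of \<open>x\<^sup>\<alpha> g\<^sub>j\<close> by smaller vectors: up to vectors of degree at most
  \<open>|\<alpha>|\<close>, which are smaller than \<open>x\<^sub>a x\<^sup>\<alpha> g\<^sub>j\<close>, this multiplies all monomials by \<open>x\<^sub>a\<close> and so keeps
  their order.
\<close>

lemma standard_add_mset:
  assumes "add_mset a \<alpha> \<in> standard j" and "j < r"
  shows "\<alpha> \<in> standard j"
proof (rule ccontr)
  let ?lower = "\<lambda>\<alpha>. span (vector_at ` {q\<in>exponents. q < (size \<alpha>, \<alpha>, j)})"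
  assume "\<alpha> \<notin> standard j"
  moreover have \<alpha>: "set_mset \<alpha> \<subseteq> {..<n}" "a < n"
    using assms by (auto simp: standard_def)
  ultimately have "monomial_vector \<alpha> j \<in> ?lower \<alpha>"
    by (simp add: standard_def)
  have filt_lower: "filt (size \<alpha>) \<subseteq> ?lower (add_mset a \<alpha>)"
    unfolding filt_eq_span_monomials by (intro span_mono) auto
  have "X a (monomial_vector \<alpha> j) \<in> ?lower (add_mset a \<alpha>)"
  proof (rule X_span [OF \<open>monomial_vector \<alpha> j \<in> ?lower \<alpha>\<close>])
    fix x assume "x \<in> vector_at ` {q\<in>exponents. q < (size \<alpha>, \<alpha>, j)}"
    then obtain \<beta> i where x: "x = monomial_vector \<beta> i" and \<beta>: "set_mset \<beta> \<subseteq> {..<n}" "i < r"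
      and less: "(size \<beta>, \<beta>, i) < (size \<alpha>, \<alpha>, j)"
      by (auto simp: exponents_def vector_at_def)
    have "size \<beta> \<le> size \<alpha>"
      using less by auto
    then have "X a x - monomial_vector (add_mset a \<beta>) i \<in> ?lower (add_mset a \<alpha>)"
      using X_monomial_vector [OF \<beta>(1) \<alpha>(2) \<beta>(2)] filt_lower filt_mono x by blast
    moreover have "(size (add_mset a \<beta>), add_mset a \<beta>, i) < (size (add_mset a \<alpha>), add_mset a \<alpha>, j)"
      using less by (auto simp: less_le add_mset_lt_right_lt add_mset_le_right_le)
    then have "monomial_vector (add_mset a \<beta>) i \<in> ?lower (add_mset a \<alpha>)"
      using \<beta> \<alpha>(2)
      by (intro span_base image_eqI [of _ _ "(size (add_mset a \<beta>), add_mset a \<beta>, i)"])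
        (auto simp: vector_at_def)
    ultimately have "X a x - monomial_vector (add_mset a \<beta>) i + monomial_vector (add_mset a \<beta>) i
        \<in> ?lower (add_mset a \<alpha>)"
      by (rule span_add)
    then show "X a x \<in> ?lower (add_mset a \<alpha>)"
      by simp
  qed
  moreover have "X a (monomial_vector \<alpha> j) - monomial_vector (add_mset a \<alpha>) j
      \<in> ?lower (add_mset a \<alpha>)"
    using X_monomial_vector [OF \<alpha> \<open>j < r\<close>] filt_lower by blast
  ultimately have "X a (monomial_vector \<alpha> j)
      - (X a (monomial_vector \<alpha> j) - monomial_vector (add_mset a \<alpha>) j) \<in> ?lower (add_mset a \<alpha>)"
    by (rule span_diff)
  then show False
    using assms(1) by (simp add: standard_def)
qed

lemma down_set_standard:
  assumes "j < r"
  shows "down_set n (standard j)"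
  unfolding down_set_def
proof (intro conjI ballI allI impI)
  fix \<alpha> \<beta> assume "\<alpha> \<in> standard j" "\<beta> \<subseteq># \<alpha>"
  then obtain \<gamma> where "\<alpha> = \<beta> + \<gamma>"
    by (metis subset_mset.le_iff_add)
  with \<open>\<alpha> \<in> standard j\<close> have "\<beta> + \<gamma> \<in> standard j"
    by simp
  then show "\<beta> \<in> standard j"
    by (induction \<gamma>) (auto intro: standard_add_mset [OF _ assms])
qed (simp add: standard_def)

lemma dim_filt: "dim (filt k) = (\<Sum>j<r. \<Sum>s\<le>k. card {\<alpha>\<in>standard j. size \<alpha> = s})"
proof -
  let ?J = "{p\<in>exponents. fst p \<le> k}"
  let ?A = "\<lambda>(j, s). (\<lambda>\<alpha>. (s, \<alpha>, j)) ` {\<alpha>\<in>standard j. size \<alpha> = s}"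
  have "dim (filt k) = card {p\<in>?J. vector_at p \<notin> span (vector_at ` {q\<in>?J. q < p})}"
    unfolding filt_eq_span_monomials dim_span by (rule dim_eq_card_standard [OF finite_exponents])
  also have "{p\<in>?J. vector_at p \<notin> span (vector_at ` {q\<in>?J. q < p})} = (\<Union>js\<in>{..<r} \<times> {..k}. ?A js)"
  proof -
    \<comment> \<open>The order compares degrees first, so all predecessors of an index of degree at most \<open>k\<close> are
      in \<open>?J\<close>, and being standard does not depend on \<open>k\<close>.\<close>
    have "{q\<in>?J. q < p} = {q\<in>exponents. q < p}" if "p \<in> ?J" for p
      using that by (cases p) auto
    then have "{p\<in>?J. vector_at p \<notin> span (vector_at ` {q\<in>?J. q < p})} =
        {p\<in>?J. vector_at p \<notin> span (vector_at ` {q\<in>exponents. q < p})}"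
      by (intro Collect_cong) (auto cong: conj_cong)
    also have "\<dots> = (\<Union>js\<in>{..<r} \<times> {..k}. ?A js)"
      by (auto simp: exponents_def standard_def vector_at_def)
    finally show ?thesis .
  qed
  also have "card \<dots> = (\<Sum>js\<in>{..<r} \<times> {..k}. card (?A js))"
    by (rule card_UN_disjoint)
      (auto intro!: finite_imageI finite_down_set_size [OF down_set_standard])
  also have "\<dots> = (\<Sum>(j, s)\<in>{..<r} \<times> {..k}. card {\<alpha>\<in>standard j. size \<alpha> = s})"
    by (intro sum.cong) (auto intro!: card_image simp: inj_on_def)
  also have "\<dots> = (\<Sum>j<r. \<Sum>s\<le>k. card {\<alpha>\<in>standard j. size \<alpha> = s})"
    by (simp add: sum.cartesian_product)
  finally show ?thesis .
qed

lemma eventually_polynomial_dim_filt: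
  "eventually_polynomial (\<lambda>k. of_nat (dim (filt k)) :: 'a::field_char_0)"
proof -
  have "eventually_polynomial (\<lambda>k. of_nat (card {\<alpha>\<in>standard j. size \<alpha> = k}) :: 'a)"
    if "j < r" for j
    using eventually_polynomial_card_down_set [OF down_set_standard [OF that]] .
  then have "eventually_polynomial
      (\<lambda>k. \<Sum>j<r. \<Sum>s\<le>k. of_nat (card {\<alpha>\<in>standard j. size \<alpha> = s}) :: 'a)"
    by (intro eventually_polynomial_sum eventually_polynomial_partial_sums) simp
  then show ?thesis
    by (simp add: dim_filt)
qed

end

section \<open>Modules over the enveloping algebra\<close>

lemma poly_mapping_eq_sum_single:
  "a = (\<Sum>w\<in>Poly_Mapping.keys a. Poly_Mapping.single w (Poly_Mapping.lookup a w))"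
  by (rule poly_mapping_eqI)
    (auto simp: lookup_sum lookup_single when_def in_keys_iff)

context lie_algebra
begin

lemma enveloping_class_closed: "enveloping_class a \<in> carrier enveloping_algebra"
  using ring_hom_closed [OF enveloping_class_ring_hom] by (simp add: free_algebra_def)

lemma enveloping_class_add:
  "enveloping_class (a + b) = enveloping_class a \<oplus>\<^bsub>enveloping_algebra\<^esub> enveloping_class b"
  using ring_hom_add [OF enveloping_class_ring_hom, of a b] by (simp add: free_algebra_def)

lemma enveloping_class_mult:
  "enveloping_class (a * b) = enveloping_class a \<otimes>\<^bsub>enveloping_algebra\<^esub> enveloping_class b"
  using ring_hom_mult [OF enveloping_class_ring_hom, of a b] by (simp add: free_algebra_def)

lemma enveloping_class_one: "enveloping_class 1 = \<one>\<^bsub>enveloping_algebra\<^esub>"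
  using ring_hom_one [OF enveloping_class_ring_hom] by (simp add: free_algebra_def)

lemma carrier_enveloping_algebra: "carrier enveloping_algebra = range enveloping_class"
  by (auto simp: enveloping_algebra_def FactRing_def A_RCOSETS_def' enveloping_class_def
      free_algebra_def)

lemma enveloping_class_relation:
  assumes "a - b \<in> enveloping_relations"
  shows "enveloping_class a = enveloping_class b"
proof -
  interpret ideal enveloping_ideal "free_algebra :: ('g free_monoid \<Rightarrow>\<^sub>0 'f) ring"
    by (rule enveloping_ideal)
  interpret Q: ring enveloping_algebra
    by (rule ring_enveloping_algebra)
  have "a - b \<in> enveloping_ideal"
    using assms genideal_self [of enveloping_relations]
    by (auto simp: enveloping_ideal_def free_algebra_def)
  moreover have "a - b \<in> carrier free_algebra"
    by (simp add: free_algebra_def)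
  ultimately have "enveloping_ideal +>\<^bsub>free_algebra\<^esub> (a - b) = enveloping_ideal"
    by (intro a_coset_join2 a_subgroup)
  then have "enveloping_class (a - b) = \<zero>\<^bsub>enveloping_algebra\<^esub>"
    by (simp add: enveloping_class_def enveloping_algebra_def FactRing_def)
  then show ?thesis
    using enveloping_class_add [of "a - b" b] enveloping_class_closed [of b] by simp
qed

end

context enveloping_module
begin

text \<open>The action of an element of the Lie algebra on the module.\<close>

definition lie_act :: "'g \<Rightarrow> 'm \<Rightarrow> 'm" where
  "lie_act x m = act (enveloping_class (var x)) m"

lemma act_class_add: "act (enveloping_class (a + b)) m
    = act (enveloping_class a) m + act (enveloping_class b) m"
  by (simp add: enveloping_class_add U.act_add_left enveloping_class_closed)

lemma act_class_mult: "act (enveloping_class (a * b)) m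
    = act (enveloping_class a) (act (enveloping_class b) m)"
  by (simp add: enveloping_class_mult U.act_mult enveloping_class_closed)

lemma act_class_right_add: "act (enveloping_class a) (m + m')
    = act (enveloping_class a) m + act (enveloping_class a) m'"
  by (rule U.act_add_right [OF enveloping_class_closed])

lemma act_class_zero: "act (enveloping_class 0) m = 0"
  using act_class_add [of 0 0 m] by simp

lemma act_class_sum: "act (enveloping_class (\<Sum>i\<in>I. a i)) m = (\<Sum>i\<in>I. act (enveloping_class (a i)) m)"
  by (induction I rule: infinite_finite_induct) (simp_all add: act_class_zero act_class_add)

lemma lie_act_add: "lie_act x (m + m') = lie_act x m + lie_act x m'"
  unfolding lie_act_def by (rule act_class_right_add)

lemma lie_act_scale: "lie_act x (mscale c m) = mscale c (lie_act x m)"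
proof -
  have "var x * const c = const c * (var x :: 'g free_monoid \<Rightarrow>\<^sub>0 'f)"
    by (simp add: var_def const_def mult_single)
  then show ?thesis
    unfolding lie_act_def mscale_def by (metis act_class_mult)
qed

lemma lie_act_zero: "lie_act x 0 = 0"
  using lie_act_add [of x 0 0] by simp

lemma lie_act_add_left: "lie_act (x + y) m = lie_act x m + lie_act y m"
proof -
  have "enveloping_class (var (x + y)) = enveloping_class (var x + var y)"
    by (rule enveloping_class_relation) (auto simp: enveloping_relations_def)
  then show ?thesis
    by (simp add: lie_act_def act_class_add)
qed

lemma lie_act_scale_left: "lie_act (scale c x) m = mscale c (lie_act x m)"
proof -
  have "enveloping_class (var (scale c x)) = enveloping_class (const c * var x)"
    by (rule enveloping_class_relation) (auto simp: enveloping_relations_def)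
  then show ?thesis
    by (simp add: lie_act_def mscale_def act_class_mult)
qed

lemma lie_act_zero_left: "lie_act 0 m = 0"
  using lie_act_add_left [of 0 0 m] by simp

lemma lie_act_bracket: "lie_act x (lie_act y m) - lie_act y (lie_act x m) = lie_act (bracket x y) m"
proof -
  have "var x * var y - (var y * var x + var (bracket x y)) \<in> enveloping_relations"
    by (auto simp: enveloping_relations_def diff_diff_eq)
  then have "enveloping_class (var x * var y) = enveloping_class (var y * var x + var (bracket x y))"
    by (rule enveloping_class_relation)
  then show ?thesis
    unfolding lie_act_def by (metis act_class_add act_class_mult add_diff_cancel_left')
qed

lemma act_class_word:
  "act (enveloping_class (Poly_Mapping.single (Word w) 1)) m = foldr lie_act w m"
proof (induction w)
  case Nil
  have "Poly_Mapping.single (Word []) 1 = (1 :: 'g free_monoid \<Rightarrow>\<^sub>0 'f)"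
    by (simp flip: zero_free_monoid_def)
  then show ?case
    by (simp add: enveloping_class_one U.act_one)
next
  case (Cons x w)
  have "Poly_Mapping.single (Word (x # w)) 1
      = var x * (Poly_Mapping.single (Word w) 1 :: 'g free_monoid \<Rightarrow>\<^sub>0 'f)"
    by (simp add: var_def mult_single plus_free_monoid_def)
  with Cons.IH show ?case
    by (simp add: act_class_mult lie_act_def)
qed

lemma act_class_eq_sum_words:
  "act (enveloping_class a) m =
    (\<Sum>w\<in>Poly_Mapping.keys a. mscale (Poly_Mapping.lookup a w) (foldr lie_act (letters w) m))"
proof -
  have "act (enveloping_class (Poly_Mapping.single w c)) m = mscale c (foldr lie_act (letters w) m)"
    for w c
  proof -
    have "Poly_Mapping.single w c = const c * Poly_Mapping.single (Word (letters w)) 1"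
      by (simp add: const_def mult_single)
    then show ?thesis
      using act_class_word [of "letters w" m] by (simp only: act_class_mult mscale_def)
  qed
  then show ?thesis
    by (subst poly_mapping_eq_sum_single) (simp add: act_class_sum)
qed

lemma subspace_module_filtration: "M.subspace (module_filtration N k)"
  unfolding module_filtration_def act_span_def by (rule M.subspace_span)

lemma act_in_module_filtration:
  assumes "\<forall>w\<in>Poly_Mapping.keys a. length (letters w) \<le> k" and "m \<in> N"
  shows "act (enveloping_class a) m \<in> module_filtration N k"
  unfolding module_filtration_def act_span_def
  by (rule M.span_base) (use assms in \<open>auto simp: enveloping_filtration_def\<close>)

lemma module_filtration_induct [consumes 1, case_names zero step]:
  assumes "m \<in> module_filtration N k" and "P 0"
    and "\<And>c a n y. \<forall>w\<in>Poly_Mapping.keys a. length (letters w) \<le> k \<Longrightarrow> n \<in> N \<Longrightarrow> P y \<Longrightarrow>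
      P (mscale c (act (enveloping_class a) n) + y)"
  shows "P m"
  using assms(1) unfolding module_filtration_def act_span_def
  by (induction rule: M.span_induct_alt) (auto simp: enveloping_filtration_def intro: assms(2,3))

lemma module_filtration_mono:
  assumes "k \<le> l"
  shows "module_filtration N k \<subseteq> module_filtration N l"
proof -
  have "enveloping_filtration k \<subseteq> enveloping_filtration l"
    using assms by (auto simp: enveloping_filtration_def intro!: imageI intro: order_trans)
  then show ?thesis
    unfolding module_filtration_def act_span_def by (intro M.span_mono) blast
qed

lemma lie_act_module_filtration:
  assumes "m \<in> module_filtration N k"
  shows "lie_act x m \<in> module_filtration N (Suc k)"
  using assms
proof (induction rule: module_filtration_induct)
  case zero
  show ?case
    by (simp add: lie_act_zero M.subspace_0 [OF subspace_module_filtration])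
next
  case (step c a n y)
  have "length (letters w) \<le> Suc k" if "w \<in> Poly_Mapping.keys (var x * a)" for w
    using that keys_mult [of "var x" a] step(1)
    by (fastforce simp: var_def plus_free_monoid_def)
  then have "act (enveloping_class (var x * a)) n \<in> module_filtration N (Suc k)"
    using step(2) by (intro act_in_module_filtration) auto
  then have "mscale c (act (enveloping_class (var x * a)) n) + lie_act x y \<in> module_filtration N (Suc k)"
    using step(3) subspace_module_filtration by (intro M.subspace_add M.subspace_scale)
  then show ?case
    by (simp add: lie_act_add lie_act_scale act_class_mult flip: lie_act_def)
qed

lemma act_class_module_filtration:
  assumes "m \<in> module_filtration N k" and "\<forall>w\<in>Poly_Mapping.keys a. length (letters w) \<le> l"
  shows "act (enveloping_class a) m \<in> module_filtration N (k + l)"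
  unfolding act_class_eq_sum_words
proof (intro M.subspace_sum M.subspace_scale subspace_module_filtration)
  fix w assume "w \<in> Poly_Mapping.keys a"
  have "foldr lie_act u m \<in> module_filtration N (k + length u)" for u
    by (induction u) (simp_all add: assms(1) lie_act_module_filtration)
  moreover have "k + length (letters w) \<le> k + l"
    using assms(2) \<open>w \<in> Poly_Mapping.keys a\<close> by simp
  ultimately show "foldr lie_act (letters w) m \<in> module_filtration N (k + l)"
    using module_filtration_mono by blast
qed

text \<open>\<open>U\<^sub>k N \<subseteq> U\<^sub>k U\<^sub>s N' \<subseteq> U\<^bsub>k+s\<^esub> N'\<close>.\<close>

lemma module_filtration_subset_shift:
  assumes "N \<subseteq> module_filtration N' s"
  shows "module_filtration N k \<subseteq> module_filtration N' (k + s)"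
proof
  fix m assume "m \<in> module_filtration N k"
  then show "m \<in> module_filtration N' (k + s)"
  proof (induction rule: module_filtration_induct)
    case zero
    show ?case
      by (rule M.subspace_0 [OF subspace_module_filtration])
  next
    case (step c a n y)
    then have "act (enveloping_class a) n \<in> module_filtration N' (s + k)"
      using assms by (intro act_class_module_filtration) auto
    with step(3) show ?case
      using subspace_module_filtration
      by (intro M.subspace_add M.subspace_scale) (simp_all add: add.commute)
  qed
qed

lemma generates_imp_in_module_filtration:
  assumes "generates N"
  shows "\<exists>k. m \<in> module_filtration N k"
proof -
  have "m \<in> M.span {act a n | a n. a \<in> carrier enveloping_algebra \<and> n \<in> N}"
    using assms unfolding generates_def act_span_def by simp
  then show ?thesis
  proof (induction rule: M.span_induct_alt)
    case base
    show ?case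
      using M.subspace_0 [OF subspace_module_filtration] by blast
  next
    case (step c x y)
    then obtain a n k where x: "x = act (enveloping_class a) n" "n \<in> N"
      and y: "y \<in> module_filtration N k"
      by (auto simp: carrier_enveloping_algebra)
    \<comment> \<open>The maximum is taken together with \<open>0\<close>, since \<open>a = 0\<close> has no words.\<close>
    define l where "l = Max (insert 0 ((\<lambda>w. length (letters w)) ` Poly_Mapping.keys a))"
    have "\<forall>w\<in>Poly_Mapping.keys a. length (letters w) \<le> l"
      unfolding l_def by (intro ballI Max_ge) auto
    then have "x \<in> module_filtration N l"
      using x by (simp add: act_in_module_filtration)
    then have "mscale c x + y \<in> module_filtration N (max k l)"
      using y module_filtration_mono [of k "max k l" N] module_filtration_mono [of l "max k l" N]
      by (intro M.subspace_add M.subspace_scale subspace_module_filtration) auto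
    then show ?case by blast
  qed
qed

lemma fin_dim_subset_module_filtration:
  assumes "generates N'" and "fin_dim_subspace mscale N"
  shows "\<exists>s. N \<subseteq> module_filtration N' s"
proof -
  obtain B where B: "finite B" "N = M.span B"
    using assms(2) unfolding fin_dim_subspace_def by blast
  from B(1) have "\<exists>s. B \<subseteq> module_filtration N' s"
  proof (induction B)
    case empty
    show ?case by simp
  next
    case (insert b B)
    then obtain s where s: "B \<subseteq> module_filtration N' s" by blast
    obtain t where t: "b \<in> module_filtration N' t"
      using generates_imp_in_module_filtration [OF assms(1)] by blast
    have "insert b B \<subseteq> module_filtration N' (max s t)"
      using s t module_filtration_mono [of s "max s t" N'] module_filtration_mono [of t "max s t" N']
      by auto
    then show ?case by blast
  qed
  then show ?thesis
    using M.span_minimal subspace_module_filtration unfolding B(2) by blast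
qed

text \<open>
  The filtration \<open>U\<^sub>k N\<close> is defined by words over the whole Lie algebra; words over a finite spanning
  set give the same subspaces.
\<close>

lemma module_filtration_eq_filt:
  assumes g: "span (xs ` {..<n}) = UNIV" and N: "N = M.span (gs ` {..<r})"
  shows "lie_operators mscale n (\<lambda>i. lie_act (xs i))"
    and "module_filtration N k = lie_operators.filt mscale n r (\<lambda>i. lie_act (xs i)) gs k"
proof -
  have expand: "lie_act x m \<in> M.span ((\<lambda>i. lie_act (xs i) m) ` {..<n})" for x m
  proof -
    have "x \<in> span (xs ` {..<n})"
      using g by simp
    then show ?thesis
    proof (induction rule: span_induct_alt)
      case base
      show ?case by (simp add: lie_act_zero_left M.span_zero)
    next
      case (step c x y)
      then have "lie_act x m \<in> M.span ((\<lambda>i. lie_act (xs i) m) ` {..<n})"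
        by (auto intro: M.span_base)
      with step(2) show ?case
        by (simp add: lie_act_add_left lie_act_scale_left M.span_add M.span_scale)
    qed
  qed
  show lie_ops: "lie_operators mscale n (\<lambda>i. lie_act (xs i))"
    by unfold_locales (simp_all add: lie_act_add lie_act_scale lie_act_bracket expand)
  interpret L: lie_operators mscale n r "\<lambda>i. lie_act (xs i)" gs
    by (rule lie_ops)
  have word: "L.apply_word w m = foldr lie_act (map xs w) m" for w m
    by (induction w) simp_all
  show "module_filtration N k = L.filt k"
  proof
    show "L.filt k \<subseteq> module_filtration N k"
      unfolding L.filt_def
    proof (rule M.span_minimal [OF _ subspace_module_filtration], rule subsetI)
      fix m assume "m \<in> {L.apply_word w (gs j) | w j. set w \<subseteq> {..<n} \<and> length w \<le> k \<and> j < r}"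
      then obtain w j where m: "m = L.apply_word w (gs j)" "length w \<le> k" "j < r"
        by blast
      have "gs j \<in> N"
        using N m(3) by (auto intro: M.span_base)
      then have "act (enveloping_class (Poly_Mapping.single (Word (map xs w)) 1)) (gs j)
          \<in> module_filtration N k"
        using m(2) by (intro act_in_module_filtration) auto
      then show "m \<in> module_filtration N k"
        by (simp add: m(1) word act_class_word)
    qed
    show "module_filtration N k \<subseteq> L.filt k"
    proof
      have step: "lie_act x m \<in> L.filt (Suc l)" if "m \<in> L.filt l" for x m l
      proof -
        have "(\<lambda>i. lie_act (xs i) m) ` {..<n} \<subseteq> L.filt (Suc l)"
          using L.X_filt [OF that] by auto
        then show ?thesis
          using expand M.span_minimal [OF _ L.subspace_filt] by blast
      qed
      have "N \<subseteq> L.filt 0"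
        unfolding N
        by (intro M.span_minimal L.subspace_filt) (auto dest: L.word_in_filt [of "[]" 0, simplified])
      then have words: "foldr lie_act w m \<in> L.filt (length w)" if "m \<in> N" for w m
        using that by (induction w) (auto intro: step)
      fix m assume "m \<in> module_filtration N k"
      then show "m \<in> L.filt k"
      proof (induction rule: module_filtration_induct)
        case zero
        show ?case by (rule M.subspace_0 [OF L.subspace_filt])
      next
        case (step c a m y)
        have "foldr lie_act (letters w) m \<in> L.filt k" if "w \<in> Poly_Mapping.keys a" for w
          using words [OF step(2)] L.filt_mono step(1) that by blast
        then have "act (enveloping_class a) m \<in> L.filt k"
          unfolding act_class_eq_sum_words
          by (intro M.subspace_sum M.subspace_scale L.subspace_filt)
        with step(3) show ?case
          by (intro M.subspace_add M.subspace_scale L.subspace_filt)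
      qed
    qed
  qed
qed

lemma module_filtration_fin_dim_and_polynomial:
  assumes "fin_dim_subspace scale UNIV" and "fin_dim_subspace mscale N"
  shows "\<exists>F. finite F \<and> module_filtration N k \<subseteq> M.span F"
    and "eventually_polynomial (\<lambda>k. of_nat (M.dim (module_filtration N k)) :: 'a::field_char_0)"
proof -
  obtain B C where B: "finite B" "UNIV = span B" and C: "finite C" "N = M.span C"
    using assms unfolding fin_dim_subspace_def by blast
  obtain n :: nat and xs where xs: "B = xs ` {i. i < n}"
    using finite_imp_nat_seg_image_inj_on [OF B(1)] by blast
  obtain r :: nat and gs where gs: "C = gs ` {i. i < r}"
    using finite_imp_nat_seg_image_inj_on [OF C(1)] by blast
  have g: "span (xs ` {..<n}) = UNIV" and N: "N = M.span (gs ` {..<r})"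
    using B C xs gs by (simp_all add: lessThan_def)
  interpret L: lie_operators mscale n r "\<lambda>i. lie_act (xs i)" gs
    by (rule module_filtration_eq_filt(1) [OF g N])
  have eq: "module_filtration N k = L.filt k" for k
    by (rule module_filtration_eq_filt(2) [OF g N])
  show "\<exists>F. finite F \<and> module_filtration N k \<subseteq> M.span F"
    unfolding eq L.filt_eq_span_monomials using L.finite_exponents by blast
  show "eventually_polynomial (\<lambda>k. of_nat (M.dim (module_filtration N k)) :: 'a)"
    unfolding eq by (rule L.eventually_polynomial_dim_filt)
qed

lemma hilbert_polynomial_eq_backward_difference:
  assumes "fin_dim_subspace scale UNIV" and "fin_dim_subspace mscale N"
    and P: "\<forall>\<^sub>F k in sequentially. poly P (of_nat k) = of_nat (M.dim (module_filtration N k))"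
  shows "hilbert_polynomial N = P - pcompose P [:- 1, 1:]"
proof -
  have quot: "quotient_dim mscale (module_filtration N k) (module_filtration N (k - 1))
      + M.dim (module_filtration N (k - 1)) = M.dim (module_filtration N k)" for k
  proof -
    obtain F where "finite F" "module_filtration N k \<subseteq> M.span F"
      using module_filtration_fin_dim_and_polynomial(1) [OF assms(1,2)] by blast
    then show ?thesis
      by (intro M.quotient_dim_add_dim [of _ F] subspace_module_filtration module_filtration_mono) auto
  qed
  obtain K where K: "poly P (of_nat k) = of_nat (M.dim (module_filtration N k))" if "k \<ge> K" for k
    using P unfolding eventually_sequentially by blast
  have "poly (P - pcompose P [:- 1, 1:]) (of_nat k)
      = of_nat (quotient_dim mscale (module_filtration N k) (module_filtration N (k - 1)))"
    if "k \<ge> Suc K" for k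
  proof -
    have "poly (pcompose P [:- 1, 1:]) (of_nat k) = poly P (of_nat (k - 1))"
      using that by (simp add: poly_pcompose of_nat_diff)
    then show ?thesis
      using K [of k] K [of "k - 1"] that quot [of k] by (simp flip: quot [of k])
  qed
  then have ev: "\<forall>\<^sub>F k in sequentially. poly (P - pcompose P [:- 1, 1:]) (of_nat k)
      = of_nat (quotient_dim mscale (module_filtration N k) (module_filtration N (k - 1)))"
    by (rule eventually_sequentiallyI)
  show ?thesis
    unfolding hilbert_polynomial_def
  proof (rule the_equality)
    show "\<forall>\<^sub>F k in sequentially. poly (P - pcompose P [:- 1, 1:]) (of_nat k)
      = of_nat (quotient_dim mscale (module_filtration N k) (module_filtration N (k - 1)))"
      by (rule ev)
  next
    fix p :: "rat poly"
    assume "\<forall>\<^sub>F k in sequentially. poly p (of_nat k)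
      = of_nat (quotient_dim mscale (module_filtration N k) (module_filtration N (k - 1)))"
    with ev have "\<forall>\<^sub>F k in sequentially. poly p (of_nat k) = poly (P - pcompose P [:- 1, 1:]) (of_nat k)"
      by eventually_elim simp
    then show "p = P - pcompose P [:- 1, 1:]"
      by (rule poly_eqI_sequentially)
  qed
qed

lemma dim_module_filtration_le_shift:
  assumes "fin_dim_subspace scale UNIV" and N: "fin_dim_subspace mscale N"
    and N': "fin_dim_subspace mscale N'" "generates N'"
  shows "\<exists>s. \<forall>k. M.dim (module_filtration N k) \<le> M.dim (module_filtration N' (k + s))"
proof -
  obtain s where s: "N \<subseteq> module_filtration N' s"
    using fin_dim_subset_module_filtration [OF N'(2) N] by blast
  have "M.dim (module_filtration N k) \<le> M.dim (module_filtration N' (k + s))" for k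
  proof -
    obtain F where "finite F" "module_filtration N' (k + s) \<subseteq> M.span F"
      using module_filtration_fin_dim_and_polynomial(1) [OF assms(1) N'(1)] by blast
    then show ?thesis
      using module_filtration_subset_shift [OF s] M.span_superset
      by (intro M.dim_mono_finite [of _ _ F]) blast+
  qed
  then show ?thesis by blast
qed

lemma lead_coeff_hilbert_polynomial_eq:
  assumes g: "fin_dim_subspace scale UNIV"
    and N: "fin_dim_subspace mscale N" "generates N"
    and N': "fin_dim_subspace mscale N'" "generates N'"
  shows "lead_coeff (hilbert_polynomial N) = lead_coeff (hilbert_polynomial N')"
proof -
  have ex: "\<exists>P :: rat poly. \<forall>\<^sub>F k in sequentially. poly P (of_nat k) = of_nat (M.dim (module_filtration L k))"
    if "fin_dim_subspace mscale L" for L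
    using module_filtration_fin_dim_and_polynomial(2) [OF g that]
    unfolding eventually_polynomial_def .
  obtain P P' :: "rat poly"
    where P: "\<forall>\<^sub>F k in sequentially. poly P (of_nat k) = of_nat (M.dim (module_filtration N k))"
      and P': "\<forall>\<^sub>F k in sequentially. poly P' (of_nat k) = of_nat (M.dim (module_filtration N' k))"
    using ex [OF N(1)] ex [OF N'(1)] by blast
  have shift: "\<forall>\<^sub>F k in sequentially. poly Q (of_nat (k + s)) = of_nat (M.dim (module_filtration L (k + s)))"
    if "\<forall>\<^sub>F k in sequentially. poly Q (of_nat k) = of_nat (M.dim (module_filtration L k))"
    for Q :: "rat poly" and L s
    using that unfolding eventually_sequentially by (meson le_add1 order_trans)
  obtain s where s: "M.dim (module_filtration N k) \<le> M.dim (module_filtration N' (k + s))" for k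
    using dim_module_filtration_le_shift [OF g N(1) N'] by blast
  obtain t where t: "M.dim (module_filtration N' k) \<le> M.dim (module_filtration N (k + t))" for k
    using dim_module_filtration_le_shift [OF g N'(1) N] by blast
  have "lead_coeff (P - pcompose P [:- 1, 1:]) = lead_coeff (P' - pcompose P' [:- 1, 1:])"
  proof (rule lead_coeff_backward_difference_eq)
    show "\<forall>\<^sub>F k in sequentially. poly P (of_nat k) \<ge> 0"
      using P by eventually_elim simp
    show "\<forall>\<^sub>F k in sequentially. poly P' (of_nat k) \<ge> 0"
      using P' by eventually_elim simp
    show "\<forall>\<^sub>F k in sequentially. poly P (of_nat k) \<le> poly P' (of_nat (k + s))"
      using P shift [OF P', of s] by eventually_elim (simp only: of_nat_le_iff s)
    show "\<forall>\<^sub>F k in sequentially. poly P' (of_nat k) \<le> poly P (of_nat (k + t))"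
      using P' shift [OF P, of t] by eventually_elim (simp only: of_nat_le_iff t)
  qed
  then show ?thesis
    using hilbert_polynomial_eq_backward_difference [OF g N(1) P]
      hilbert_polynomial_eq_backward_difference [OF g N'(1) P'] by simp
qed

end

theorem proposition4p1:
  fixes scale :: "'f::field_char_0 \<Rightarrow> 'g::ab_group_add \<Rightarrow> 'g"
    and bracket :: "'g \<Rightarrow> 'g \<Rightarrow> 'g"
    and act :: "('g free_monoid \<Rightarrow>\<^sub>0 'f) set \<Rightarrow> 'm::ab_group_add \<Rightarrow> 'm"
    and M0 M0' :: "'m set"
  assumes "lie_algebra scale bracket"
    and "fin_dim_subspace scale UNIV"
    and "lie_algebra.semisimple scale bracket"
    and "enveloping_module scale bracket act"
    and "enveloping_module.finitely_generated scale bracket act"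
    and "fin_dim_subspace (enveloping_module.mscale scale bracket act) M0"
    and "fin_dim_subspace (enveloping_module.mscale scale bracket act) M0'"
    and "enveloping_module.generates scale bracket act M0"
    and "enveloping_module.generates scale bracket act M0'"
  shows "lead_coeff (enveloping_module.hilbert_polynomial scale bracket act M0) =
         lead_coeff (enveloping_module.hilbert_polynomial scale bracket act M0')"
  using enveloping_module.lead_coeff_hilbert_polynomial_eq [OF assms(4,2,6,8,7,9)] .

end
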